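(* There exist non-flat compact Hermitian surfaces with zero Gauduchon holomorphic sectional curvature. That is, there exist a compact Hermitian surface $(M,J,g)$ (complex dimension $2$) and $t\in\mathbb R$ such that the Gauduchon connection $\nabla^t$ of $g$ has identically zero holomorphic sectional curvature while the curvature tensor of $\nabla^t$ does not vanish identically.
   Context: Gauduchon connections. Let $(M,J,g)$ be a Hermitian manifold with Levi-Civita connection $\nabla^{LC}$. The Chern connection $\nabla^c$ is the unique connection with $\nabla^c g=0$, $\nabla^c J=0$ and torsion having vanishing $(1,1)$ part. The Lichnerowicz connection $\nabla^l$ is the connection induced by $\nabla^{LC}$ on $T^{1,0}M$ by projection: if $\{e_i\}$ is a local frame of $T^{1,0}M$ and $\nabla^{LC}e_i=(\theta_1)_i^je_j+\overline{(\theta_2)_i^j}\,\bar e_j$, then $\nabla^l e_i=(\theta_1)_i^je_j$ (as a real connection on $TM$: $\nabla^l_XY=\frac12(\nabla^{LC}_XY-J\nabla^{LC}_X(JY))$). For $t\in\mathbb R$ the Gauduchon connection is $\nabla^t=t\nabla^c+(1-t)\nabla^l$. Holomorphic sectional curvature. For a metric connection $\nabla$ ($\nabla g=0$), put $R^\nabla(X,Y)Z=\nabla_X\nabla_YZ-\nabla_Y\nabla_XZ-\nabla_{[X,Y]}Z$ and $R^\nabla(X,Y,Z,W)=g(R^\nabla(X,Y)Z,W)$. The holomorphic sectional curvature of the $J$-invariant plane spanned by $X,JX$ ($X\in TM\setminus\{0\}$) is $R^\nabla(X,JX,JX,X)/|X|^4$. *)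

theory Defs
  imports "HOL-Analysis.Analysis" "HOL-Library.Function_Algebras"
begin

section \<open>Smooth and holomorphic maps on open sets\<close>

fun Ck_on :: "nat \<Rightarrow> ('b::real_normed_vector \<Rightarrow> 'c::real_normed_vector) \<Rightarrow> 'b set \<Rightarrow> bool" where
  "Ck_on 0 f S \<longleftrightarrow> continuous_on S f"
| "Ck_on (Suc k) f S \<longleftrightarrow>
     (\<forall>x\<in>S. f differentiable (at x)) \<and>
     (\<forall>v. Ck_on k (\<lambda>x. frechet_derivative f (at x) v) S)"

definition smooth_on :: "('b::real_normed_vector \<Rightarrow> 'c::real_normed_vector) \<Rightarrow> 'b set \<Rightarrow> bool" where
  "smooth_on f S \<longleftrightarrow> (\<forall>k. Ck_on k f S)"

definition holomorphic_map_on :: "(complex^'n \<Rightarrow> complex^'m) \<Rightarrow> (complex^'n) set \<Rightarrow> bool" where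
  "holomorphic_map_on f S \<longleftrightarrow>
     (\<forall>x\<in>S. \<exists>f'. (f has_derivative f') (at x) \<and> (\<forall>v. f' (\<i> *s v) = \<i> *s f' v))"


section \<open>Complex manifolds\<close>

text \<open>A chart is a pair of its domain and its coordinate map (only relevant on the domain).\<close>

type_synonym ('a, 'n) chart = "'a set \<times> ('a \<Rightarrow> complex^'n)"

definition chart_inv :: "('a, 'n) chart \<Rightarrow> complex^'n \<Rightarrow> 'a" where
  "chart_inv c = inv_into (fst c) (snd c)"

definition transition :: "('a, 'n) chart \<Rightarrow> ('a, 'n) chart \<Rightarrow> complex^'n \<Rightarrow> complex^'n" where
  "transition c d = snd d \<circ> chart_inv c"

definition complex_manifold :: "'a topology \<Rightarrow> ('a, 'n::finite) chart set \<Rightarrow> bool" where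
  "complex_manifold M A \<longleftrightarrow>
     Hausdorff_space M \<and> second_countable M \<and>
     (\<forall>(U, \<phi>)\<in>A. openin M U \<and> open (\<phi> ` U) \<and>
        homeomorphic_map (subtopology M U) (top_of_set (\<phi> ` U)) \<phi>) \<and>
     (\<Union>c\<in>A. fst c) = topspace M \<and>
     (\<forall>c\<in>A. \<forall>d\<in>A. holomorphic_map_on (transition c d) (snd c ` (fst c \<inter> fst d)))"


section \<open>Tangent vectors and vector fields\<close>

text \<open>A tangent vector is given by its components in all charts around the base point, related by
  the differentials of the coordinate changes; the components in other charts are normalised to
  \<open>0\<close>. Real tangent vectors of an \<open>n\<close>-dimensional complex manifold thus have components in
  \<open>\<complex>\<^sup>n = \<real>\<^sup>2\<^sup>n\<close>, and the complex structure \<open>J\<close> is multiplication by \<open>\<i>\<close> in every chart.\<close>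

type_synonym ('a, 'n) tvec = "('a, 'n) chart \<Rightarrow> complex^'n"
type_synonym ('a, 'n) vfield = "'a \<Rightarrow> ('a, 'n) tvec"

definition tangent_space :: "('a, 'n::finite) chart set \<Rightarrow> 'a \<Rightarrow> ('a, 'n) tvec set" where
  "tangent_space A p =
     {u. (\<forall>c. \<not> (c \<in> A \<and> p \<in> fst c) \<longrightarrow> u c = 0) \<and>
         (\<forall>c\<in>A. \<forall>d\<in>A. p \<in> fst c \<inter> fst d \<longrightarrow>
            u d = frechet_derivative (transition c d) (at (snd c p)) (u c))}"

definition scale_tvec :: "real \<Rightarrow> ('a, 'n::finite) tvec \<Rightarrow> ('a, 'n) tvec" where
  "scale_tvec r u = (\<lambda>c. r *\<^sub>R u c)"

definition J_tvec :: "('a, 'n::finite) tvec \<Rightarrow> ('a, 'n) tvec" where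
  "J_tvec u = (\<lambda>c. \<i> *s u c)"

definition smooth_function :: "('a, 'n::finite) chart set \<Rightarrow> ('a \<Rightarrow> real) \<Rightarrow> bool" where
  "smooth_function A f \<longleftrightarrow> (\<forall>c\<in>A. smooth_on (f \<circ> chart_inv c) (snd c ` fst c))"

definition local_rep :: "('a, 'n) vfield \<Rightarrow> ('a, 'n) chart \<Rightarrow> complex^'n \<Rightarrow> complex^'n" where
  "local_rep X c = (\<lambda>x. X (chart_inv c x) c)"

definition vector_fields :: "('a, 'n::finite) chart set \<Rightarrow> ('a, 'n) vfield set" where
  "vector_fields A =
     {X. (\<forall>p. X p \<in> tangent_space A p) \<and>
         (\<forall>c\<in>A. smooth_on (local_rep X c) (snd c ` fst c))}"

definition scale_vf :: "('a \<Rightarrow> real) \<Rightarrow> ('a, 'n::finite) vfield \<Rightarrow> ('a, 'n) vfield" where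
  "scale_vf f X = (\<lambda>p. scale_tvec (f p) (X p))"

definition J_vf :: "('a, 'n::finite) vfield \<Rightarrow> ('a, 'n) vfield" where
  "J_vf X = (\<lambda>p. J_tvec (X p))"

text \<open>The derivative \<open>X f\<close>, computed in an arbitrary chart around the point.\<close>

definition vf_apply :: "('a, 'n::finite) chart set \<Rightarrow> ('a, 'n) vfield \<Rightarrow> ('a \<Rightarrow> real) \<Rightarrow> 'a \<Rightarrow> real" where
  "vf_apply A X f p =
     (let c = (SOME c. c \<in> A \<and> p \<in> fst c)
      in frechet_derivative (f \<circ> chart_inv c) (at (snd c p)) (X p c))"

definition lie_bracket ::
  "('a, 'n::finite) chart set \<Rightarrow> ('a, 'n) vfield \<Rightarrow> ('a, 'n) vfield \<Rightarrow> ('a, 'n) vfield" where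
  "lie_bracket A X Y = (\<lambda>p c.
     if c \<in> A \<and> p \<in> fst c
     then frechet_derivative (local_rep Y c) (at (snd c p)) (X p c)
        - frechet_derivative (local_rep X c) (at (snd c p)) (Y p c)
     else 0)"


section \<open>Hermitian metrics\<close>

type_synonym ('a, 'n) metric_tensor = "'a \<Rightarrow> ('a, 'n) tvec \<Rightarrow> ('a, 'n) tvec \<Rightarrow> real"

definition hermitian_metric :: "('a, 'n::finite) chart set \<Rightarrow> ('a, 'n) metric_tensor \<Rightarrow> bool" where
  "hermitian_metric A g \<longleftrightarrow>
     (\<forall>p\<in>(\<Union>c\<in>A. fst c).
        (\<forall>u\<in>tangent_space A p. \<forall>v\<in>tangent_space A p. \<forall>w\<in>tangent_space A p.
           g p (u + v) w = g p u w + g p v w) \<and>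
        (\<forall>r. \<forall>u\<in>tangent_space A p. \<forall>v\<in>tangent_space A p.
           g p (scale_tvec r u) v = r * g p u v) \<and>
        (\<forall>u\<in>tangent_space A p. \<forall>v\<in>tangent_space A p. g p u v = g p v u) \<and>
        (\<forall>u\<in>tangent_space A p. u \<noteq> 0 \<longrightarrow> 0 < g p u u) \<and>
        (\<forall>u\<in>tangent_space A p. \<forall>v\<in>tangent_space A p. g p (J_tvec u) (J_tvec v) = g p u v)) \<and>
     (\<forall>X\<in>vector_fields A. \<forall>Y\<in>vector_fields A. smooth_function A (\<lambda>p. g p (X p) (Y p)))"


section \<open>Connections\<close>

type_synonym ('a, 'n) connection = "('a, 'n) vfield \<Rightarrow> ('a, 'n) vfield \<Rightarrow> ('a, 'n) vfield"

definition affine_connection ::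
  "('a, 'n::finite) chart set \<Rightarrow> ('a, 'n) connection \<Rightarrow> bool" where
  "affine_connection A D \<longleftrightarrow>
     (\<forall>X\<in>vector_fields A. \<forall>Y\<in>vector_fields A. D X Y \<in> vector_fields A) \<and>
     (\<forall>X\<in>vector_fields A. \<forall>Y\<in>vector_fields A. \<forall>Z\<in>vector_fields A.
        D (X + Y) Z = D X Z + D Y Z \<and> D X (Y + Z) = D X Y + D X Z) \<and>
     (\<forall>f X Y. smooth_function A f \<longrightarrow> X \<in> vector_fields A \<longrightarrow> Y \<in> vector_fields A \<longrightarrow>
        D (scale_vf f X) Y = scale_vf f (D X Y) \<and>
        D X (scale_vf f Y) = scale_vf (vf_apply A X f) Y + scale_vf f (D X Y))"

definition torsion ::
  "('a, 'n::finite) chart set \<Rightarrow> ('a, 'n) connection \<Rightarrow> ('a, 'n) vfield \<Rightarrow> ('a, 'n) vfield \<Rightarrow> ('a, 'n) vfield" where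
  "torsion A D X Y = D X Y - D Y X - lie_bracket A X Y"

text \<open>The \<open>(1,1)\<close> part of a real (vector valued) 2-form \<open>T\<close> is
  \<open>(X, Y) \<mapsto> (T(X, Y) + T(JX, JY)) / 2\<close>, since \<open>T(JZ, JW)\<close> equals \<open>- T(Z, W)\<close> if the complex
  vectors \<open>Z, W\<close> are both of type \<open>(1,0)\<close> or both of type \<open>(0,1)\<close>, and \<open>T(Z, W)\<close> if they are of
  opposite types.\<close>

definition torsion_1_1 ::
  "('a, 'n::finite) chart set \<Rightarrow> ('a, 'n) connection \<Rightarrow> ('a, 'n) vfield \<Rightarrow> ('a, 'n) vfield \<Rightarrow> ('a, 'n) vfield" where
  "torsion_1_1 A D X Y = scale_vf (\<lambda>_. 1/2) (torsion A D X Y + torsion A D (J_vf X) (J_vf Y))"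

definition metric_connection ::
  "('a, 'n::finite) chart set \<Rightarrow> ('a, 'n) metric_tensor \<Rightarrow> ('a, 'n) connection \<Rightarrow> bool" where
  "metric_connection A g D \<longleftrightarrow>
     affine_connection A D \<and>
     (\<forall>X\<in>vector_fields A. \<forall>Y\<in>vector_fields A. \<forall>Z\<in>vector_fields A. \<forall>p\<in>(\<Union>c\<in>A. fst c).
        vf_apply A X (\<lambda>q. g q (Y q) (Z q)) p = g p (D X Y p) (Z p) + g p (Y p) (D X Z p))"

definition levi_civita_connection ::
  "('a, 'n::finite) chart set \<Rightarrow> ('a, 'n) metric_tensor \<Rightarrow> ('a, 'n) connection \<Rightarrow> bool" where
  "levi_civita_connection A g D \<longleftrightarrow>
     metric_connection A g D \<and>
     (\<forall>X\<in>vector_fields A. \<forall>Y\<in>vector_fields A. torsion A D X Y = 0)"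

definition chern_connection ::
  "('a, 'n::finite) chart set \<Rightarrow> ('a, 'n) metric_tensor \<Rightarrow> ('a, 'n) connection \<Rightarrow> bool" where
  "chern_connection A g D \<longleftrightarrow>
     metric_connection A g D \<and>
     (\<forall>X\<in>vector_fields A. \<forall>Y\<in>vector_fields A. D X (J_vf Y) = J_vf (D X Y)) \<and>
     (\<forall>X\<in>vector_fields A. \<forall>Y\<in>vector_fields A. torsion_1_1 A D X Y = 0)"

definition lichnerowicz :: "('a, 'n::finite) connection \<Rightarrow> ('a, 'n) connection" where
  "lichnerowicz D X Y = scale_vf (\<lambda>_. 1/2) (D X Y - J_vf (D X (J_vf Y)))"

text \<open>The Levi-Civita and Chern connections are determined by their defining properties on smooth
  vector fields, hence so is the Gauduchon connection.\<close>

definition gauduchon_connection ::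
  "('a, 'n::finite) chart set \<Rightarrow> ('a, 'n) metric_tensor \<Rightarrow> real \<Rightarrow> ('a, 'n) connection \<Rightarrow> bool" where
  "gauduchon_connection A g t D \<longleftrightarrow>
     (\<exists>D_LC D_c. levi_civita_connection A g D_LC \<and> chern_connection A g D_c \<and>
        (\<forall>X\<in>vector_fields A. \<forall>Y\<in>vector_fields A.
           D X Y = scale_vf (\<lambda>_. t) (D_c X Y) + scale_vf (\<lambda>_. 1 - t) (lichnerowicz D_LC X Y)))"


section \<open>Curvature\<close>

definition curvature ::
  "('a, 'n::finite) chart set \<Rightarrow> ('a, 'n) connection \<Rightarrow>
     ('a, 'n) vfield \<Rightarrow> ('a, 'n) vfield \<Rightarrow> ('a, 'n) vfield \<Rightarrow> ('a, 'n) vfield" where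
  "curvature A D X Y Z = D X (D Y Z) - D Y (D X Z) - D (lie_bracket A X Y) Z"

definition curvature4 ::
  "('a, 'n::finite) chart set \<Rightarrow> ('a, 'n) metric_tensor \<Rightarrow> ('a, 'n) connection \<Rightarrow>
     ('a, 'n) vfield \<Rightarrow> ('a, 'n) vfield \<Rightarrow> ('a, 'n) vfield \<Rightarrow> ('a, 'n) vfield \<Rightarrow> 'a \<Rightarrow> real" where
  "curvature4 A g D X Y Z W p = g p (curvature A D X Y Z p) (W p)"

text \<open>The holomorphic sectional curvature of the plane spanned by \<open>X p\<close> and \<open>J (X p)\<close>. It depends
  on \<open>X\<close> only through \<open>X p\<close>, and on a (Hausdorff, second countable) manifold every tangent vector
  at \<open>p\<close> is the value of a global smooth vector field.\<close>

definition hol_sect_curv ::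
  "('a, 'n::finite) chart set \<Rightarrow> ('a, 'n) metric_tensor \<Rightarrow> ('a, 'n) connection \<Rightarrow>
     ('a, 'n) vfield \<Rightarrow> 'a \<Rightarrow> real" where
  "hol_sect_curv A g D X p =
     curvature4 A g D X (J_vf X) (J_vf X) X p / (sqrt (g p (X p) (X p))) ^ 4"

definition zero_hol_sect_curv ::
  "('a, 'n::finite) chart set \<Rightarrow> ('a, 'n) metric_tensor \<Rightarrow> ('a, 'n) connection \<Rightarrow> bool" where
  "zero_hol_sect_curv A g D \<longleftrightarrow>
     (\<forall>X\<in>vector_fields A. \<forall>p\<in>(\<Union>c\<in>A. fst c). X p \<noteq> 0 \<longrightarrow> hol_sect_curv A g D X p = 0)"

definition flat_connection ::
  "('a, 'n::finite) chart set \<Rightarrow> ('a, 'n) connection \<Rightarrow> bool" where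
  "flat_connection A D \<longleftrightarrow>
     (\<forall>X\<in>vector_fields A. \<forall>Y\<in>vector_fields A. \<forall>Z\<in>vector_fields A. curvature A D X Y Z = 0)"

end

theory Submission
  imports Defs
begin

text \<open>
  The example is the Hopf surface obtained from \<open>\<complex>\<^sup>2 - {0}\<close> by dividing out multiplication by
  \<open>exp (2\<pi>)\<close>, with the metric induced by \<open>|dz|\<^sup>2 / |z|\<^sup>2\<close>, and \<open>t = 3\<close>. All coordinate changes are
  homotheties, so everything can be computed in the coordinate \<open>z\<close>. There the Gauduchon connection is
  \<open>\<nabla>\<^sub>X Y = dY(X) - Q(z, X, Y) / |z|\<^sup>2\<close> with an explicit real-trilinear \<open>Q\<close>, and for \<open>s = (1 - t) / 2\<close>
  its holomorphic sectional curvature in the direction \<open>X\<close> is proportional to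
  \<open>(s\<^sup>2 - 1) (|z|\<^sup>2 |X|\<^sup>2 - |\<langle>X, z\<rangle>|\<^sup>2)\<close> with the Hermitian product \<open>\<langle>X, z\<rangle>\<close>. It vanishes for
  \<open>t = -1\<close>, where the connection is flat, and for \<open>t = 3\<close>, where it is not.
\<close>

section \<open>Calculus of smooth maps\<close>

text \<open>Homotheties are what spares all gluing. A scaling z -> r z has constant differential, so
  the naive derivative dY(X) already transforms like a tangent vector, and Q(z, X, Y) / |z|^2 has
  degree 3 - 2 = 1 under scaling, which is the same behaviour. A connection defined chart by chart
  is therefore consistent. The factor exp (2 pi) makes ln |z| modulo the group action an ordinary
  angle, so (z / |z|, cis (ln |z|)) separates the orbits and the quotient becomes a subset of a
  vector space. Flatness is a statement about global vector fields; linear maps of C^2 commute with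
  scalings and hence induce such fields, with enough values at a point to exhibit curvature. What
  separates t = 3 from the flat case t = -1 is the component R(u, iu, x, ix) at the point x, for a
  unitary pair x, u: it equals -2 (s - 1)^2, which has only the root s = 1, whereas the factor s^2 -
  1 has the additional root s = -1.\<close>

lemma frechet_derivative_eqI:
  "(f has_derivative f') (at x) \<Longrightarrow> frechet_derivative f (at x) = f'"
  by (metis frechet_derivative_at)

lemma frechet_derivative_cong_open:
  assumes "open S" "x \<in> S" "\<And>y. y \<in> S \<Longrightarrow> f y = g y"
  shows "frechet_derivative f (at x) = frechet_derivative g (at x)"
proof -
  have "(f has_derivative F) (at x) \<longleftrightarrow> (g has_derivative F) (at x)" for F
    using assms by (metis has_derivative_transform_within_open)
  then show ?thesis by (simp add: frechet_derivative_def)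
qed

lemma differentiable_cong_open:
  assumes "open S" "x \<in> S" "\<And>y. y \<in> S \<Longrightarrow> f y = g y" "f differentiable (at x)"
  shows "g differentiable (at x)"
  using assms by (metis differentiable_def has_derivative_transform_within_open)

lemma Ck_on_cong:
  assumes "open S" "\<And>x. x \<in> S \<Longrightarrow> f x = g x" "Ck_on k f S"
  shows "Ck_on k g S"
  using assms(2,3)
proof (induction k arbitrary: f g)
  case 0
  then show ?case by (simp cong: continuous_on_cong)
next
  case (Suc k)
  have "Ck_on k (\<lambda>x. frechet_derivative g (at x) v) S" for v
  proof (rule Suc.IH)
    show "Ck_on k (\<lambda>x. frechet_derivative f (at x) v) S" using Suc.prems by simp
    show "frechet_derivative f (at x) v = frechet_derivative g (at x) v" if "x \<in> S" for x
      using frechet_derivative_cong_open[OF assms(1) that] Suc.prems(1) by metis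
  qed
  moreover have "g differentiable (at x)" if "x \<in> S" for x
    using differentiable_cong_open[OF assms(1) that Suc.prems(1)] Suc.prems that by simp
  ultimately show ?case by simp
qed

lemma Ck_on_SucD: "Ck_on (Suc k) f S \<Longrightarrow> Ck_on k f S"
proof (induction k arbitrary: f)
  case 0
  then show ?case
    by (meson Ck_on.simps differentiable_at_imp_differentiable_on differentiable_imp_continuous_on)
next
  case (Suc k)
  then show ?case by (metis Ck_on.simps(2))
qed

lemma Ck_on_const: "Ck_on k (\<lambda>x. c) S"
  by (induction k arbitrary: c) (simp_all)

lemma Ck_on_id: "Ck_on k (\<lambda>x. x) S"
  by (cases k) (simp_all add: Ck_on_const frechet_derivative_eqI[OF has_derivative_ident])

text \<open>Allows an explicit derivative \<open>F\<close> in place of the chosen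
  \<open>frechet_derivative\<close>. The two agree on \<open>S\<close>, and openness of
  \<open>S\<close> lets \<open>Ck_on_cong\<close> transfer the lower orders.\<close>

lemma Ck_on_SucI:
  assumes "open S" "\<And>x. x \<in> S \<Longrightarrow> (f has_derivative F x) (at x)"
    and "\<And>v. Ck_on k (\<lambda>x. F x v) S"
  shows "Ck_on (Suc k) f S"
proof -
  have "Ck_on k (\<lambda>x. frechet_derivative f (at x) v) S" for v
    by (rule Ck_on_cong[OF assms(1) _ assms(3)[of v]]) (metis assms(2) frechet_derivative_eqI)
  then show ?thesis using assms(2) by (auto simp: differentiable_def)
qed

lemma Ck_on_SucE:
  assumes "Ck_on (Suc k) f S"
  shows "\<And>x. x \<in> S \<Longrightarrow> (f has_derivative frechet_derivative f (at x)) (at x)"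
    and "\<And>v. Ck_on k (\<lambda>x. frechet_derivative f (at x) v) S"
  using assms frechet_derivative_works by auto

lemma Ck_on_bounded_linear:
  assumes L: "bounded_linear L" and S: "open S"
  shows "Ck_on k f S \<Longrightarrow> Ck_on k (\<lambda>x. L (f x)) S"
proof (induction k arbitrary: f)
  case 0
  then show ?case using bounded_linear.continuous_on[OF L] by simp
next
  case (Suc k)
  note f = Ck_on_SucE[OF Suc.prems]
  show ?case
    by (rule Ck_on_SucI[OF S bounded_linear.has_derivative[OF L f(1)] Suc.IH[OF f(2)]])
qed

lemma Ck_on_add:
  assumes S: "open S"
  shows "Ck_on k f S \<Longrightarrow> Ck_on k g S \<Longrightarrow> Ck_on k (\<lambda>x. f x + g x) S"
proof (induction k arbitrary: f g)
  case 0
  then show ?case by (simp add: continuous_on_add)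
next
  case (Suc k)
  note f = Ck_on_SucE[OF Suc.prems(1)] and g = Ck_on_SucE[OF Suc.prems(2)]
  show ?case
    by (rule Ck_on_SucI[OF S has_derivative_add[OF f(1) g(1)] Suc.IH[OF f(2) g(2)]])
qed

text \<open>The product rule yields two terms of the same bilinear shape, each with one factor
  differentiated, so the induction runs over all pairs of factors. The undifferentiated factor is
  used one order below what it has.\<close>

lemma Ck_on_bilinear:
  assumes B: "bounded_bilinear B" and S: "open S"
  shows "Ck_on k f S \<Longrightarrow> Ck_on k g S \<Longrightarrow> Ck_on k (\<lambda>x. B (f x) (g x)) S"
proof (induction k arbitrary: f g)
  case 0
  then show ?case by (simp add: bounded_bilinear.continuous_on[OF B])
next
  case (Suc k)
  note f = Ck_on_SucE[OF Suc.prems(1)] and g = Ck_on_SucE[OF Suc.prems(2)]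
  show ?case
    by (rule Ck_on_SucI[OF S bounded_bilinear.FDERIV[OF B f(1) g(1)]], assumption, assumption)
      (intro Ck_on_add[OF S] Suc.IH f(2) g(2) Ck_on_SucD[OF Suc.prems(1)] Ck_on_SucD[OF Suc.prems(2)])
qed

text \<open>The derivative -(1/f) f' (1/f) involves only f' and 1/f itself at one order less, so the
  induction can keep \<open>f\<close> fixed.\<close>

lemma Ck_on_inverse:
  fixes f :: "'a::real_normed_vector \<Rightarrow> real"
  assumes S: "open S" and nz: "\<And>x. x \<in> S \<Longrightarrow> f x \<noteq> 0"
  shows "Ck_on k f S \<Longrightarrow> Ck_on k (\<lambda>x. inverse (f x)) S"
proof (induction k)
  case 0
  then show ?case using nz by (simp add: continuous_on_inverse)
next
  case (Suc k)
  note f = Ck_on_SucE[OF Suc.prems]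
  note mult = Ck_on_bilinear[OF bounded_bilinear_mult S]
  have "Ck_on k (\<lambda>x. inverse (f x)) S"
    using Suc.IH Suc.prems Ck_on_SucD by blast
  then have "Ck_on k (\<lambda>x. - (inverse (f x) * frechet_derivative f (at x) v * inverse (f x))) S" for v
    by (intro Ck_on_bounded_linear[OF bounded_linear_minus[OF bounded_linear_ident] S] mult f(2))
  from Ck_on_SucI[OF S Deriv.has_derivative_inverse[OF nz f(1)] this]
  show ?case by blast
qed

lemma Ck_on_sum:
  assumes "open S" "finite I" "\<And>i. i \<in> I \<Longrightarrow> Ck_on k (f i) S"
  shows "Ck_on k (\<lambda>x. \<Sum>i\<in>I. f i x) S"
  using assms(2,3)
  by (induction I rule: finite_induct) (auto intro!: Ck_on_add Ck_on_const assms(1))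

lemma smooth_on_cong:
  "open S \<Longrightarrow> smooth_on f S \<Longrightarrow> (\<And>x. x \<in> S \<Longrightarrow> f x = g x) \<Longrightarrow> smooth_on g S"
  unfolding smooth_on_def using Ck_on_cong by blast

lemma smooth_on_id: "smooth_on (\<lambda>x. x) S"
  by (simp add: smooth_on_def Ck_on_id)

lemma smooth_on_bounded_linear:
  "bounded_linear L \<Longrightarrow> open S \<Longrightarrow> smooth_on f S \<Longrightarrow> smooth_on (\<lambda>x. L (f x)) S"
  by (simp add: smooth_on_def Ck_on_bounded_linear)

lemma smooth_on_add:
  "open S \<Longrightarrow> smooth_on f S \<Longrightarrow> smooth_on g S \<Longrightarrow> smooth_on (\<lambda>x. f x + g x) S"
  by (simp add: smooth_on_def Ck_on_add)

lemma smooth_on_diff: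
  assumes "open S" "smooth_on f S" "smooth_on g S"
  shows "smooth_on (\<lambda>x. f x - g x) S"
  using smooth_on_add[OF assms(1,2) smooth_on_bounded_linear[OF bounded_linear_minus[OF bounded_linear_ident] assms(1,3)]]
  by simp

lemma smooth_on_scaleR:
  "open S \<Longrightarrow> smooth_on f S \<Longrightarrow> smooth_on g S \<Longrightarrow> smooth_on (\<lambda>x. f x *\<^sub>R g x) S"
  by (simp add: smooth_on_def Ck_on_bilinear[OF bounded_bilinear_scaleR])

lemma smooth_on_inner:
  "open S \<Longrightarrow> smooth_on f S \<Longrightarrow> smooth_on g S \<Longrightarrow> smooth_on (\<lambda>x. f x \<bullet> g x) S"
  by (simp add: smooth_on_def Ck_on_bilinear[OF bounded_bilinear_inner])

lemma smooth_on_inverse: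
  fixes f :: "'a::real_normed_vector \<Rightarrow> real"
  shows "open S \<Longrightarrow> smooth_on f S \<Longrightarrow> (\<And>x. x \<in> S \<Longrightarrow> f x \<noteq> 0) \<Longrightarrow> smooth_on (\<lambda>x. inverse (f x)) S"
  by (simp add: smooth_on_def Ck_on_inverse)

lemma smooth_on_sum:
  "open S \<Longrightarrow> finite I \<Longrightarrow> (\<And>i. i \<in> I \<Longrightarrow> smooth_on (f i) S) \<Longrightarrow> smooth_on (\<lambda>x. \<Sum>i\<in>I. f i x) S"
  by (simp add: smooth_on_def Ck_on_sum)

lemma smooth_on_has_derivative:
  "smooth_on f S \<Longrightarrow> x \<in> S \<Longrightarrow> (f has_derivative frechet_derivative f (at x)) (at x)"
  unfolding smooth_on_def using Ck_on_SucE(1) by blast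

lemma smooth_on_frechet_derivative:
  "smooth_on f S \<Longrightarrow> smooth_on (\<lambda>x. frechet_derivative f (at x) v) S"
  unfolding smooth_on_def using Ck_on_SucE(2) by blast

lemma linear_sum_Basis:
  fixes L :: "'a::euclidean_space \<Rightarrow> 'b::real_vector"
  assumes "linear L"
  shows "L v = (\<Sum>b\<in>Basis. (v \<bullet> b) *\<^sub>R L b)"
proof -
  have "L v = L (\<Sum>b\<in>Basis. (v \<bullet> b) *\<^sub>R b)" by (simp add: euclidean_representation)
  also have "\<dots> = (\<Sum>b\<in>Basis. (v \<bullet> b) *\<^sub>R L b)"
    by (simp add: linear_sum[OF assms] linear_cmul[OF assms])
  finally show ?thesis .
qed

lemma frechet_derivative_sum_Basis:
  fixes f :: "'a::euclidean_space \<Rightarrow> 'b::real_normed_vector"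
  assumes "smooth_on f S" "x \<in> S"
  shows "frechet_derivative f (at x) v = (\<Sum>b\<in>Basis. (v \<bullet> b) *\<^sub>R frechet_derivative f (at x) b)"
  by (rule linear_sum_Basis)
    (use smooth_on_has_derivative[OF assms] has_derivative_linear in blast)

text \<open>\<open>Ck_on\<close> controls derivatives in constant directions only; expanding the
  moving direction \<open>X x\<close> in the basis reduces to these.\<close>

lemma smooth_on_frechet_derivative_along:
  fixes f :: "'a::euclidean_space \<Rightarrow> 'b::real_normed_vector"
  assumes S: "open S" and f: "smooth_on f S" and X: "smooth_on X S"
  shows "smooth_on (\<lambda>x. frechet_derivative f (at x) (X x)) S"
proof (rule smooth_on_cong[OF S])
  show "smooth_on (\<lambda>x. \<Sum>b\<in>Basis. (X x \<bullet> b) *\<^sub>R frechet_derivative f (at x) b) S"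
    by (intro smooth_on_sum smooth_on_scaleR smooth_on_frechet_derivative f S
        smooth_on_bounded_linear[OF bounded_linear_inner_left] X) simp
qed (metis frechet_derivative_sum_Basis[OF f])

section \<open>Symmetry of second derivatives\<close>

text \<open>The mean value theorem is used twice: along \<open>u\<close> for the increment of
  \<open>f\<close> in direction \<open>v\<close>, then along \<open>v\<close> for the derivative of
  \<open>f\<close> in direction \<open>u\<close>. The bound on \<open>s\<close> keeps the whole
  parallelogram inside the ball.\<close>

lemma second_difference_mean_value:
  fixes f :: "'a::real_normed_vector \<Rightarrow> real"
  assumes f: "\<And>y. y \<in> ball x d \<Longrightarrow> (f has_derivative f' y) (at y)"
    and f': "\<And>y. y \<in> ball x d \<Longrightarrow> ((\<lambda>y. f' y u) has_derivative f'' y) (at y)"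
    and s: "s > 0" "s * (norm u + norm v) < d"
  obtains y where "y \<in> ball x d"
    "f (x + s *\<^sub>R u + s *\<^sub>R v) - f (x + s *\<^sub>R u) - f (x + s *\<^sub>R v) + f x = s\<^sup>2 * f'' y v"
proof -
  have inb: "x + a *\<^sub>R u + b *\<^sub>R v \<in> ball x d" if "0 \<le> a" "a \<le> s" "0 \<le> b" "b \<le> s" for a b
  proof -
    have "norm (a *\<^sub>R u + b *\<^sub>R v) \<le> a * norm u + b * norm v"
      using norm_triangle_ineq[of "a *\<^sub>R u" "b *\<^sub>R v"] that by simp
    also have "\<dots> \<le> s * (norm u + norm v)"
      unfolding distrib_left using that by (intro add_mono mult_right_mono) auto
    finally have "norm (a *\<^sub>R u + b *\<^sub>R v) < d" using s by simp
    then show ?thesis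
      by (metis add.assoc add_diff_cancel_left' dist_commute dist_norm mem_ball)
  qed
  have lin: "linear (f' y)" "linear (f'' y)" if "y \<in> ball x d" for y
    using f[OF that] f'[OF that] has_derivative_linear by blast+
  \<comment> \<open>The summand \<open>0 *\<^sub>R v\<close> keeps both points in the form that
    \<open>inb\<close> covers, so one rule differentiates both terms.\<close>
  define \<phi> where "\<phi> a = f (x + a *\<^sub>R u + s *\<^sub>R v) - f (x + a *\<^sub>R u + 0 *\<^sub>R v)" for a
  have "(\<phi> has_derivative (\<lambda>h. f' (x + a *\<^sub>R u + s *\<^sub>R v) (h *\<^sub>R u) - f' (x + a *\<^sub>R u + 0 *\<^sub>R v) (h *\<^sub>R u)))
          (at a within {0..s})" if "0 \<le> a" "a \<le> s" for a
    unfolding \<phi>_def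
    by (rule has_derivative_diff; rule has_derivative_compose[of "\<lambda>a. x + a *\<^sub>R u + _ *\<^sub>R v" _ _ _ f, OF _ f[OF inb]])
      (use that s in \<open>auto intro!: derivative_eq_intros\<close>)
  from mvt_simple[OF s(1) this] obtain a where a: "a \<in> {0<..<s}"
    and "\<phi> s - \<phi> 0 = f' (x + a *\<^sub>R u + s *\<^sub>R v) ((s - 0) *\<^sub>R u) - f' (x + a *\<^sub>R u + 0 *\<^sub>R v) ((s - 0) *\<^sub>R u)"
    by blast
  then have 1: "\<phi> s - \<phi> 0 = s * (f' (x + a *\<^sub>R u + s *\<^sub>R v) u - f' (x + a *\<^sub>R u + 0 *\<^sub>R v) u)"
    using linear_cmul[OF lin(1)[OF inb[of a s]]] linear_cmul[OF lin(1)[OF inb[of a 0]]] a s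
    by (simp add: right_diff_distrib)
  have "((\<lambda>b. f' (x + a *\<^sub>R u + b *\<^sub>R v) u) has_derivative (\<lambda>h. f'' (x + a *\<^sub>R u + b *\<^sub>R v) (h *\<^sub>R v)))
          (at b within {0..s})" if "0 \<le> b" "b \<le> s" for b
    by (rule has_derivative_compose[of "\<lambda>b. x + a *\<^sub>R u + b *\<^sub>R v" _ _ _ "\<lambda>y. f' y u", OF _ f'[OF inb]])
      (use that s a in \<open>auto intro!: derivative_eq_intros\<close>)
  from mvt_simple[OF s(1) this] obtain b where b: "b \<in> {0<..<s}"
    and "f' (x + a *\<^sub>R u + s *\<^sub>R v) u - f' (x + a *\<^sub>R u + 0 *\<^sub>R v) u = f'' (x + a *\<^sub>R u + b *\<^sub>R v) ((s - 0) *\<^sub>R v)"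
    by blast
  then have "\<phi> s - \<phi> 0 = s\<^sup>2 * f'' (x + a *\<^sub>R u + b *\<^sub>R v) v"
    unfolding 1 using linear_cmul[OF lin(2)[OF inb]] a b by (simp add: power2_eq_square)
  then show thesis
    using that[OF inb[of a b]] a b by (simp add: \<phi>_def algebra_simps)
qed

text \<open>The second difference is symmetric in \<open>u\<close> and \<open>v\<close>. The mean
  value lemma thus gives points \<open>y\<close> and \<open>z\<close> near \<open>x\<close>, in
  general different, at which the two mixed derivatives agree; their continuity at \<open>x\<close>
  does the rest.\<close>

lemma frechet_derivative_commute_real:
  fixes f :: "'a::real_normed_vector \<Rightarrow> real"
  assumes S: "open S" "x \<in> S" and f: "smooth_on f S"
  shows "frechet_derivative (\<lambda>y. frechet_derivative f (at y) u) (at x) v =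
         frechet_derivative (\<lambda>y. frechet_derivative f (at y) v) (at x) u"
proof -
  define D2 where "D2 u v y = frechet_derivative (\<lambda>y. frechet_derivative f (at y) u) (at y) v" for u v y
  have cont: "isCont (D2 u v) x" for u v
  proof -
    have "smooth_on (D2 u v) S"
      unfolding D2_def using f by (intro smooth_on_frechet_derivative)
    then show ?thesis
      using S by (meson Ck_on.simps(1) continuous_on_eq_continuous_at smooth_on_def)
  qed
  have "\<bar>D2 u v x - D2 v u x\<bar> < e" if "e > 0" for e
  proof -
    obtain d0 where d0: "d0 > 0" "ball x d0 \<subseteq> S" using S open_contains_ball by blast
    obtain d1 where d1: "d1 > 0" "\<And>y. dist y x < d1 \<Longrightarrow> dist (D2 u v y) (D2 u v x) < e / 2"
      using cont[of u v] \<open>e > 0\<close> unfolding continuous_at_eps_delta by (meson half_gt_zero)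
    obtain d2 where d2: "d2 > 0" "\<And>y. dist y x < d2 \<Longrightarrow> dist (D2 v u y) (D2 v u x) < e / 2"
      using cont[of v u] \<open>e > 0\<close> unfolding continuous_at_eps_delta by (meson half_gt_zero)
    define d where "d = min d0 (min d1 d2)"
    have d: "d > 0" "ball x d \<subseteq> S" using d0 d1 d2 by (auto simp: d_def)
    \<comment> \<open>The summand 1 keeps the denominator positive even for \<open>u = v = 0\<close>
      and makes \<open>s * (norm u + norm v)\<close> strictly smaller than \<open>d\<close>.\<close>
    define s where "s = d / (norm u + norm v + 1)"
    have pos: "norm u + norm v + 1 > 0" by (simp add: add_nonneg_pos)
    have s: "s > 0" "s * (norm u + norm v) < d" "s * (norm v + norm u) < d"
      using d(1) pos by (auto simp: s_def field_simps)
    have D1: "(f has_derivative frechet_derivative f (at y)) (at y)" if "y \<in> ball x d" for y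
      using smooth_on_has_derivative[OF f] that d by blast
    have D2: "((\<lambda>y. frechet_derivative f (at y) w) has_derivative (\<lambda>z. D2 w z y)) (at y)"
      if "y \<in> ball x d" for y w
      unfolding D2_def
      using smooth_on_has_derivative[OF smooth_on_frechet_derivative[OF f]] that d by blast
    obtain y where y: "y \<in> ball x d"
      "f (x + s *\<^sub>R u + s *\<^sub>R v) - f (x + s *\<^sub>R u) - f (x + s *\<^sub>R v) + f x = s\<^sup>2 * D2 u v y"
      using second_difference_mean_value[OF D1 D2 s(1,2)] by metis
    obtain z where z: "z \<in> ball x d"
      "f (x + s *\<^sub>R v + s *\<^sub>R u) - f (x + s *\<^sub>R v) - f (x + s *\<^sub>R u) + f x = s\<^sup>2 * D2 v u z"
      using second_difference_mean_value[OF D1 D2 s(1,3)] by metis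
    have "s\<^sup>2 * D2 u v y = s\<^sup>2 * D2 v u z"
      using y(2) z(2) by (smt (verit) add.assoc add.commute)
    then have "D2 u v y = D2 v u z" using s by simp
    moreover have "dist (D2 u v y) (D2 u v x) < e / 2" "dist (D2 v u z) (D2 v u x) < e / 2"
      using y(1) z(1) by (intro d1(2) d2(2); simp add: d_def dist_commute)+
    ultimately show ?thesis unfolding dist_real_def by linarith
  qed
  then have "D2 u v x = D2 v u x"
    by (metis less_irrefl eq_iff_diff_eq_0 zero_less_abs_iff)
  then show ?thesis by (simp add: D2_def)
qed

lemma frechet_derivative_commute:
  fixes f :: "'a::real_normed_vector \<Rightarrow> 'b::euclidean_space"
  assumes S: "open S" "x \<in> S" and f: "smooth_on f S"
  shows "frechet_derivative (\<lambda>y. frechet_derivative f (at y) u) (at x) v =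
         frechet_derivative (\<lambda>y. frechet_derivative f (at y) v) (at x) u"
proof (rule euclidean_eqI)
  fix b :: 'b
  let ?f = "\<lambda>y. f y \<bullet> b"
  have 1: "frechet_derivative ?f (at y) w = frechet_derivative f (at y) w \<bullet> b" if "y \<in> S" for y w
    using frechet_derivative_eqI[OF has_derivative_inner_left[OF smooth_on_has_derivative[OF f that]]]
    by simp
  have 2: "frechet_derivative (\<lambda>y. frechet_derivative ?f (at y) w) (at x) z =
      frechet_derivative (\<lambda>y. frechet_derivative f (at y) w) (at x) z \<bullet> b" for w z
  proof -
    have "frechet_derivative (\<lambda>y. frechet_derivative ?f (at y) w) (at x) =
        frechet_derivative (\<lambda>y. frechet_derivative f (at y) w \<bullet> b) (at x)"
      by (rule frechet_derivative_cong_open[OF S]) (simp add: 1)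
    then show ?thesis
      using frechet_derivative_eqI[OF has_derivative_inner_left[OF
          smooth_on_has_derivative[OF smooth_on_frechet_derivative[OF f] S(2)]]]
      by simp
  qed
  have "smooth_on ?f S"
    by (intro smooth_on_bounded_linear[OF bounded_linear_inner_left] S f)
  from frechet_derivative_commute_real[OF S this, of u v]
  show "frechet_derivative (\<lambda>y. frechet_derivative f (at y) u) (at x) v \<bullet> b =
      frechet_derivative (\<lambda>y. frechet_derivative f (at y) v) (at x) u \<bullet> b"
    by (simp add: 2)
qed

section \<open>Covariant derivatives on punctured complex space\<close>

text \<open>A separate constant lets the simplifier treat multiplication by i as an abstract complex
  structure: real linear, isometric, with square -1.\<close>

definition mult_i :: "complex^'n \<Rightarrow> complex^'n" where
  "mult_i v = \<i> *s v"

lemma mult_i_simps [simp]: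
  "mult_i (u + v) = mult_i u + mult_i v"
  "mult_i (u - v) = mult_i u - mult_i v"
  "mult_i (- v) = - mult_i v"
  "mult_i (r *\<^sub>R v) = r *\<^sub>R mult_i v"
  "mult_i 0 = 0"
  "mult_i (mult_i v) = - v"
  by (simp_all add: mult_i_def vec_eq_iff algebra_simps)

lemma inner_mult_i [simp]: "mult_i u \<bullet> mult_i v = u \<bullet> v"
  by (simp add: mult_i_def inner_vec_def inner_complex_def algebra_simps)

lemma inner_mult_i_right: "u \<bullet> mult_i v = - (mult_i u \<bullet> v)"
  using inner_mult_i[of u "mult_i v"] by simp

lemma inner_mult_i_self [simp]: "mult_i u \<bullet> u = 0"
  using inner_mult_i_right[of u u] by (simp add: inner_commute)

lemma inner_mult_i_swap: "mult_i u \<bullet> v = - (mult_i v \<bullet> u)"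
  using inner_mult_i_right[of v u] by (simp add: inner_commute)

lemma bounded_linear_mult_i: "bounded_linear mult_i"
  by (simp add: linear_conv_bounded_linear[symmetric] linear_iff)

lemmas has_derivative_mult_i [derivative_intros] = bounded_linear.has_derivative[OF bounded_linear_mult_i]

text \<open>With \<open>Q = gform \<alpha> \<beta> \<delta>\<close>, the connection \<open>dY(X) - Q(z, X, Y) / |z|\<^sup>2\<close> preserves \<open>|dz|\<^sup>2 / |z|\<^sup>2\<close> for all
  parameters. It is the Levi-Civita connection for \<open>(\<alpha>, \<beta>, \<delta>) = (0, 1, 0)\<close>, the Chern connection for
  \<open>(1, 0, 0)\<close>, the Lichnerowicz connection for \<open>(0, 1/2, 1/2)\<close>, and hence the Gauduchon connection for
  \<open>(t, (1 - t) / 2, (1 - t) / 2)\<close>.\<close>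

definition gform :: "real \<Rightarrow> real \<Rightarrow> real \<Rightarrow> complex^'n \<Rightarrow> complex^'n \<Rightarrow> complex^'n \<Rightarrow> complex^'n" where
  "gform \<alpha> \<beta> \<delta> x u v = (x \<bullet> u) *\<^sub>R v + (\<alpha> * (mult_i x \<bullet> u)) *\<^sub>R mult_i v
     + \<beta> *\<^sub>R ((x \<bullet> v) *\<^sub>R u - (u \<bullet> v) *\<^sub>R x)
     + \<delta> *\<^sub>R ((u \<bullet> mult_i v) *\<^sub>R mult_i x - (x \<bullet> mult_i v) *\<^sub>R mult_i u)"

lemma gform_add:
  "gform \<alpha> \<beta> \<delta> (x + y) u v = gform \<alpha> \<beta> \<delta> x u v + gform \<alpha> \<beta> \<delta> y u v"
  "gform \<alpha> \<beta> \<delta> x (u + w) v = gform \<alpha> \<beta> \<delta> x u v + gform \<alpha> \<beta> \<delta> x w v"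
  "gform \<alpha> \<beta> \<delta> x u (v + w) = gform \<alpha> \<beta> \<delta> x u v + gform \<alpha> \<beta> \<delta> x u w"
  by (simp_all add: gform_def inner_simps algebra_simps)

lemma gform_scaleR:
  "gform \<alpha> \<beta> \<delta> (r *\<^sub>R x) u v = r *\<^sub>R gform \<alpha> \<beta> \<delta> x u v"
  "gform \<alpha> \<beta> \<delta> x (r *\<^sub>R u) v = r *\<^sub>R gform \<alpha> \<beta> \<delta> x u v"
  "gform \<alpha> \<beta> \<delta> x u (r *\<^sub>R v) = r *\<^sub>R gform \<alpha> \<beta> \<delta> x u v"
  by (simp_all add: gform_def inner_simps algebra_simps)

lemma gform_diff:
  "gform \<alpha> \<beta> \<delta> (x - y) u v = gform \<alpha> \<beta> \<delta> x u v - gform \<alpha> \<beta> \<delta> y u v"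
  "gform \<alpha> \<beta> \<delta> x (u - w) v = gform \<alpha> \<beta> \<delta> x u v - gform \<alpha> \<beta> \<delta> x w v"
  "gform \<alpha> \<beta> \<delta> x u (v - w) = gform \<alpha> \<beta> \<delta> x u v - gform \<alpha> \<beta> \<delta> x u w"
  by (simp_all add: gform_def inner_simps algebra_simps)

text \<open>The \<alpha>, \<beta> and \<delta> terms are skew in \<open>v\<close> and
  \<open>w\<close>, so only the first summand of \<open>gform\<close> survives. The right-hand side
  is what differentiating the conformal factor 1/|x|^2 calls for, which makes this identity metric
  compatibility.\<close>

lemma gform_skew:
  "gform \<alpha> \<beta> \<delta> x u v \<bullet> w + v \<bullet> gform \<alpha> \<beta> \<delta> x u w = 2 * (x \<bullet> u) * (v \<bullet> w)"
  by (simp add: gform_def inner_simps inner_mult_i_right algebra_simps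
      inner_commute[of v u] inner_commute[of w u] inner_commute[of w x] inner_commute[of v x]
      inner_commute[of v "mult_i _"] inner_mult_i_swap[of v x] inner_mult_i_swap[of v u])

lemma has_derivative_gform:
  assumes "(a has_derivative a') (at x)" "(b has_derivative b') (at x)" "(c has_derivative c') (at x)"
  shows "((\<lambda>y. gform \<alpha> \<beta> \<delta> (a y) (b y) (c y)) has_derivative
    (\<lambda>h. gform \<alpha> \<beta> \<delta> (a' h) (b x) (c x) + gform \<alpha> \<beta> \<delta> (a x) (b' h) (c x)
       + gform \<alpha> \<beta> \<delta> (a x) (b x) (c' h))) (at x)"
  unfolding gform_def
  by (rule derivative_eq_intros assms refl)+ (auto simp: inner_simps algebra_simps)

lemma smooth_on_gform:
  assumes "open S" "smooth_on a S" "smooth_on b S" "smooth_on c S"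
  shows "smooth_on (\<lambda>x. gform \<alpha> \<beta> \<delta> (a x) (b x) (c x)) S"
proof -
  note i = smooth_on_bounded_linear[OF bounded_linear_mult_i]
    and r = smooth_on_bounded_linear[OF bounded_linear_scaleR_right]
    and m = smooth_on_bounded_linear[OF bounded_linear_mult_right]
  show ?thesis
    unfolding gform_def
    by (intro assms smooth_on_add smooth_on_diff smooth_on_scaleR smooth_on_inner i r m)
qed

section \<open>The connections in coordinates and their curvature\<close>

definition cov :: "real \<Rightarrow> real \<Rightarrow> real \<Rightarrow> (complex^'n \<Rightarrow> complex^'n) \<Rightarrow> (complex^'n \<Rightarrow> complex^'n) \<Rightarrow>
    complex^'n \<Rightarrow> complex^'n" where
  "cov \<alpha> \<beta> \<delta> X Y x = frechet_derivative Y (at x) (X x) - inverse (x \<bullet> x) *\<^sub>R gform \<alpha> \<beta> \<delta> x (X x) (Y x)"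

lemma smooth_on_cov:
  assumes "open S" "0 \<notin> S" "smooth_on X S" "smooth_on Y S"
  shows "smooth_on (cov \<alpha> \<beta> \<delta> X Y) S"
  unfolding cov_def
  using assms(2)
  by (intro assms(1,3,4) smooth_on_diff smooth_on_frechet_derivative_along smooth_on_scaleR
      smooth_on_inverse smooth_on_inner smooth_on_id smooth_on_gform) auto

text \<open>After the product rule, symmetry of second derivatives moves the basis vector
  \<open>b\<close> into the outer slot, where linearity of a derivative collapses the sum over the
  basis.\<close>

lemma has_derivative_frechet_derivative_along:
  fixes Y :: "'a::euclidean_space \<Rightarrow> 'a" and Z :: "'a \<Rightarrow> 'b::euclidean_space"
  assumes S: "open S" "x \<in> S" and Y: "smooth_on Y S" and Z: "smooth_on Z S"
  shows "((\<lambda>y. frechet_derivative Z (at y) (Y y)) has_derivative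
    (\<lambda>h. frechet_derivative Z (at x) (frechet_derivative Y (at x) h)
       + frechet_derivative (\<lambda>y. frechet_derivative Z (at y) h) (at x) (Y x))) (at x)"
proof -
  let ?Z = "\<lambda>b y. frechet_derivative Z (at y) b"
  have dZ: "((\<lambda>y. ?Z b y) has_derivative frechet_derivative (?Z b) (at x)) (at x)" for b
    using smooth_on_has_derivative[OF smooth_on_frechet_derivative[OF Z] S(2)] .
  have dY: "(Y has_derivative frechet_derivative Y (at x)) (at x)"
    using smooth_on_has_derivative[OF Y S(2)] .
  have "((\<lambda>y. \<Sum>b\<in>Basis. (Y y \<bullet> b) *\<^sub>R ?Z b y) has_derivative
      (\<lambda>h. \<Sum>b\<in>Basis. (Y x \<bullet> b) *\<^sub>R frechet_derivative (?Z b) (at x) h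
        + (frechet_derivative Y (at x) h \<bullet> b) *\<^sub>R ?Z b x)) (at x)"
    by (intro has_derivative_sum has_derivative_scaleR has_derivative_inner_left dY dZ)
  also have "(\<lambda>h. \<Sum>b\<in>Basis. (Y x \<bullet> b) *\<^sub>R frechet_derivative (?Z b) (at x) h
        + (frechet_derivative Y (at x) h \<bullet> b) *\<^sub>R ?Z b x) =
      (\<lambda>h. frechet_derivative Z (at x) (frechet_derivative Y (at x) h) + frechet_derivative (?Z h) (at x) (Y x))"
  proof
    fix h
    have "(\<Sum>b\<in>Basis. (Y x \<bullet> b) *\<^sub>R frechet_derivative (?Z b) (at x) h) =
        (\<Sum>b\<in>Basis. (Y x \<bullet> b) *\<^sub>R frechet_derivative (?Z h) (at x) b)"
      using frechet_derivative_commute[OF S Z] by simp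
    also have "\<dots> = frechet_derivative (?Z h) (at x) (Y x)"
      using frechet_derivative_sum_Basis[OF smooth_on_frechet_derivative[OF Z] S(2)] by metis
    finally show "(\<Sum>b\<in>Basis. (Y x \<bullet> b) *\<^sub>R frechet_derivative (?Z b) (at x) h
        + (frechet_derivative Y (at x) h \<bullet> b) *\<^sub>R ?Z b x) =
        frechet_derivative Z (at x) (frechet_derivative Y (at x) h) + frechet_derivative (?Z h) (at x) (Y x)"
      by (simp add: sum.distrib frechet_derivative_sum_Basis[OF Z S(2), of "frechet_derivative Y (at x) h"])
  qed
  finally show ?thesis
    by (rule has_derivative_transform_within_open[OF _ S])
      (simp add: frechet_derivative_sum_Basis[OF Z, of _ "Y _"])
qed

text \<open>The curvature of d - \<omega> for the matrix-valued 1-form \<omega>(u) = Q(x, u, .) /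
  |x|^2, namely the commutator of \<omega>(u) and \<omega>(v) minus d\<omega>(u, v). The terms with
  2 (x . u) and 2 (x . v) come from differentiating 1/|x|^2, the last one from differentiating Q in
  its first argument.\<close>

definition curv_form :: "real \<Rightarrow> real \<Rightarrow> real \<Rightarrow> complex^'n \<Rightarrow> complex^'n \<Rightarrow> complex^'n \<Rightarrow> complex^'n \<Rightarrow> complex^'n" where
  "curv_form \<alpha> \<beta> \<delta> x u v w =
     (let Q = gform \<alpha> \<beta> \<delta>; q = inverse (x \<bullet> x) in
      q\<^sup>2 *\<^sub>R ((2 * (x \<bullet> u)) *\<^sub>R Q x v w - (2 * (x \<bullet> v)) *\<^sub>R Q x u w + Q x u (Q x v w) - Q x v (Q x u w))
      - q *\<^sub>R (Q u v w - Q v u w))"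

lemma has_derivative_cov:
  assumes S: "open S" "0 \<notin> S" "x \<in> S" and Y: "smooth_on Y S" and Z: "smooth_on Z S"
  shows "(cov \<alpha> \<beta> \<delta> Y Z has_derivative (\<lambda>h.
      frechet_derivative Z (at x) (frechet_derivative Y (at x) h)
      + frechet_derivative (\<lambda>y. frechet_derivative Z (at y) h) (at x) (Y x)
      - (inverse (x \<bullet> x) *\<^sub>R (gform \<alpha> \<beta> \<delta> h (Y x) (Z x) + gform \<alpha> \<beta> \<delta> x (frechet_derivative Y (at x) h) (Z x)
          + gform \<alpha> \<beta> \<delta> x (Y x) (frechet_derivative Z (at x) h))
        - (2 * (x \<bullet> h) * (inverse (x \<bullet> x))\<^sup>2) *\<^sub>R gform \<alpha> \<beta> \<delta> x (Y x) (Z x)))) (at x)"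
proof -
  have "x \<noteq> 0" using S by blast
  then have "((\<lambda>y. inverse (y \<bullet> y)) has_derivative (\<lambda>h. - (2 * (x \<bullet> h) * (inverse (x \<bullet> x))\<^sup>2))) (at x)"
    by (auto intro!: derivative_eq_intros simp: inner_commute power2_eq_square algebra_simps)
  note q = has_derivative_scaleR[OF this has_derivative_gform[OF has_derivative_ident
        smooth_on_has_derivative[OF Y S(3)] smooth_on_has_derivative[OF Z S(3)]]]
  show ?thesis
    unfolding cov_def
    by (rule has_derivative_eq_rhs[OF has_derivative_diff[OF
            has_derivative_frechet_derivative_along[OF S(1,3) Y Z] q]])
      (simp add: fun_eq_iff)
qed

text \<open>Second derivatives of \<open>Z\<close> cancel by symmetry, and the first derivatives of
  \<open>X\<close> and \<open>Y\<close> are absorbed by the bracket term, so the result is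
  tensorial. \<open>B\<close> is prescribed at \<open>x\<close> only, since \<open>cov\<close>
  depends on its direction only through the value there.\<close>

lemma cov_curvature:
  assumes S: "open S" "0 \<notin> S" "x \<in> S"
    and X: "smooth_on X S" and Y: "smooth_on Y S" and Z: "smooth_on Z S"
    and B: "B x = frechet_derivative Y (at x) (X x) - frechet_derivative X (at x) (Y x)"
  shows "cov \<alpha> \<beta> \<delta> X (cov \<alpha> \<beta> \<delta> Y Z) x - cov \<alpha> \<beta> \<delta> Y (cov \<alpha> \<beta> \<delta> X Z) x - cov \<alpha> \<beta> \<delta> B Z x
    = curv_form \<alpha> \<beta> \<delta> x (X x) (Y x) (Z x)"
proof -
  have lin: "linear (frechet_derivative Z (at x))"
    using smooth_on_has_derivative[OF Z S(3)] has_derivative_linear by blast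
  show ?thesis
    unfolding cov_def[of _ _ _ X "cov _ _ _ _ _"] cov_def[of _ _ _ Y "cov _ _ _ _ _"]
      frechet_derivative_eqI[OF has_derivative_cov[OF S Y Z]]
      frechet_derivative_eqI[OF has_derivative_cov[OF S X Z]]
    unfolding cov_def B linear_diff[OF lin] frechet_derivative_commute[OF S(1,3) Z, of "X x" "Y x"]
      curv_form_def Let_def
    by (simp add: gform_diff gform_scaleR algebra_simps power2_eq_square)
qed

text \<open>Arithmetic normalisation can leave numerals acting through the componentwise product of
  vectors; as real multiples they are accessible to the rules for \<open>inner\<close> and
  \<open>mult_i\<close>.\<close>

lemma vec_numeral_mult:
  "numeral n * v = (numeral n :: real) *\<^sub>R (v :: complex^'n)"
  "v * numeral n = (numeral n :: real) *\<^sub>R (v :: complex^'n)"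
  by (simp_all add: vec_eq_iff scaleR_conv_of_real)

text \<open>The weight 1 - t of the Lichnerowicz connection combines with the factor 1/2 in its
  definition to s = (1 - t) / 2, so t = 1 - 2 s and the target t = 3 is s = -1.\<close>

lemma gform_gauduchon:
  "gform (1 - 2 * s) s s x u v =
    (1 - 2 * s) *\<^sub>R gform 1 0 0 x u v + s *\<^sub>R (gform 0 1 0 x u v - mult_i (gform 0 1 0 x u (mult_i v)))"
  by (simp add: gform_def vec_numeral_mult algebra_simps)

lemma curv_form_hol_sect:
  assumes "x \<noteq> 0"
  shows "curv_form 3 (-1) (-1) x u (mult_i u) (mult_i u) \<bullet> u = 0"
proof -
  note [simp] = inner_commute[of u x] inner_commute[of u "mult_i x"] inner_mult_i_swap[of u x]
  \<comment> \<open>Once all products are expressed by |x|^2, |u|^2, x . u and ix . u, what remains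
    is a polynomial identity in these and \<open>inverse (x \<bullet> x)\<close>, valid modulo this
    relation.\<close>
  have "(x \<bullet> x) * inverse (x \<bullet> x) = 1" using assms by simp
  then show ?thesis
    by (simp add: curv_form_def gform_def Let_def vec_numeral_mult inner_simps inner_mult_i_right) algebra
qed

text \<open>Evaluated on a unitary pair, the commutator terms contribute -2 s^2 = -2 and the
  differentiated Q contributes -2 \<alpha> = -6.\<close>

lemma curv_form_nonzero:
  assumes "x \<bullet> x = 1" "u \<bullet> u = 1" "x \<bullet> u = 0" "mult_i x \<bullet> u = 0"
  shows "curv_form 3 (-1) (-1) x u (mult_i u) x \<bullet> mult_i x = - 8"
  using assms inner_mult_i_swap[of u x]
  by (simp add: curv_form_def gform_def Let_def vec_numeral_mult inner_simps inner_mult_i_right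
      inner_commute[of u x] inner_commute[of u "mult_i x"] inner_commute[of x "mult_i x"])

section \<open>Atlases whose coordinate changes are homotheties\<close>

definition atlas_conn :: "('a, 'n::finite) chart set \<Rightarrow> real \<Rightarrow> real \<Rightarrow> real \<Rightarrow> ('a, 'n) connection" where
  "atlas_conn A \<alpha> \<beta> \<delta> X Y = (\<lambda>p c.
     if c \<in> A \<and> p \<in> fst c then cov \<alpha> \<beta> \<delta> (local_rep X c) (local_rep Y c) (snd c p) else 0)"

definition atlas_metric :: "('a, 'n::finite) chart set \<Rightarrow> ('a, 'n) metric_tensor" where
  "atlas_metric A p u v =
     (let c = (SOME c. c \<in> A \<and> p \<in> fst c) in inverse (snd c p \<bullet> snd c p) * (u c \<bullet> v c))"

text \<open>The factor \<open>r\<close> depends on \<open>p\<close> because an overlap of two charts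
  can be disconnected: two annuli may meet in two components, on which the coordinate changes differ
  by a factor exp (2 pi). Hence only a neighbourhood \<open>N\<close> is required.\<close>

locale homothety_atlas =
  fixes A :: "('a, 'n::finite) chart set"
  assumes open_image: "c \<in> A \<Longrightarrow> open (snd c ` fst c)"
    and inj_on_chart: "c \<in> A \<Longrightarrow> inj_on (snd c) (fst c)"
    and zero_notin_image: "c \<in> A \<Longrightarrow> 0 \<notin> snd c ` fst c"
    and homothety: "c \<in> A \<Longrightarrow> d \<in> A \<Longrightarrow> p \<in> fst c \<Longrightarrow> p \<in> fst d \<Longrightarrow>
      \<exists>r>0. \<exists>N. open N \<and> snd c p \<in> N \<and> N \<subseteq> snd c ` fst c \<and>
        (\<forall>y\<in>N. r *\<^sub>R y \<in> snd d ` fst d \<and> chart_inv d (r *\<^sub>R y) = chart_inv c y)"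
begin

section \<open>Coordinate changes and tangent vectors\<close>

lemma chart_inv_coord: "c \<in> A \<Longrightarrow> p \<in> fst c \<Longrightarrow> chart_inv c (snd c p) = p"
  unfolding chart_inv_def by (rule inv_into_f_f[OF inj_on_chart])

lemma coord_chart_inv: "x \<in> snd c ` fst c \<Longrightarrow> snd c (chart_inv c x) = x"
  unfolding chart_inv_def by (rule f_inv_into_f)

lemma chart_inv_in: "x \<in> snd c ` fst c \<Longrightarrow> chart_inv c x \<in> fst c"
  unfolding chart_inv_def by (rule inv_into_into)

lemma coord_nonzero: "c \<in> A \<Longrightarrow> p \<in> fst c \<Longrightarrow> snd c p \<noteq> 0"
  using zero_notin_image by (metis image_eqI)

text \<open>The quotient of norms is a closed formula for \<open>r\<close>, so that later statements
  can name the factor without an existential quantifier.\<close>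

lemma homothetyE:
  assumes "c \<in> A" "d \<in> A" "p \<in> fst c" "p \<in> fst d"
  obtains r N where "r > 0" "open N" "snd c p \<in> N" "N \<subseteq> snd c ` fst c" "snd d p = r *\<^sub>R snd c p"
    "norm (snd d p) / norm (snd c p) = r"
    "\<And>y. y \<in> N \<Longrightarrow> chart_inv c y \<in> fst d"
    "\<And>y. y \<in> N \<Longrightarrow> snd d (chart_inv c y) = r *\<^sub>R y"
    "\<And>y. y \<in> N \<Longrightarrow> chart_inv d (r *\<^sub>R y) = chart_inv c y"
proof -
  obtain r N where *: "r > 0" "open N" "snd c p \<in> N" "N \<subseteq> snd c ` fst c"
    "\<And>y. y \<in> N \<Longrightarrow> r *\<^sub>R y \<in> snd d ` fst d" "\<And>y. y \<in> N \<Longrightarrow> chart_inv d (r *\<^sub>R y) = chart_inv c y"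
    using homothety[OF assms] by blast
  have 1: "snd d (chart_inv c y) = r *\<^sub>R y" "chart_inv c y \<in> fst d" if "y \<in> N" for y
    using coord_chart_inv[of "r *\<^sub>R y" d] chart_inv_in[of "r *\<^sub>R y" d] *(5,6)[OF that] by auto
  have 2: "snd d p = r *\<^sub>R snd c p"
    using 1(1)[OF *(3)] chart_inv_coord assms by simp
  then have "norm (snd d p) / norm (snd c p) = r"
    using *(1) coord_nonzero[OF assms(1,3)] by simp
  with * 1 2 that show thesis by blast
qed

lemma has_derivative_transition:
  assumes "c \<in> A" "d \<in> A" "p \<in> fst c" "p \<in> fst d"
  shows "(transition c d has_derivative (\<lambda>v. (norm (snd d p) / norm (snd c p)) *\<^sub>R v)) (at (snd c p))"
proof -
  obtain r N where *: "open N" "snd c p \<in> N" "norm (snd d p) / norm (snd c p) = r"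
    "\<And>y. y \<in> N \<Longrightarrow> snd d (chart_inv c y) = r *\<^sub>R y"
    by (rule homothetyE[OF assms]) blast
  have "((\<lambda>y. r *\<^sub>R y) has_derivative (\<lambda>v. r *\<^sub>R v)) (at (snd c p))"
    by (intro derivative_intros)
  then show ?thesis
    unfolding *(3) by (rule has_derivative_transform_within_open[OF _ *(1,2)]) (simp add: transition_def *(4))
qed

lemma tangent_space_iff:
  "u \<in> tangent_space A p \<longleftrightarrow> (\<forall>c. \<not> (c \<in> A \<and> p \<in> fst c) \<longrightarrow> u c = 0) \<and>
     (\<forall>c\<in>A. \<forall>d\<in>A. p \<in> fst c \<inter> fst d \<longrightarrow> u d = (norm (snd d p) / norm (snd c p)) *\<^sub>R u c)"
  by (auto simp: tangent_space_def frechet_derivative_eqI[OF has_derivative_transition])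

lemma holomorphic_transition:
  assumes "c \<in> A" "d \<in> A"
  shows "holomorphic_map_on (transition c d) (snd c ` (fst c \<inter> fst d))"
  unfolding holomorphic_map_on_def
proof
  fix x assume "x \<in> snd c ` (fst c \<inter> fst d)"
  then obtain p where p: "p \<in> fst c" "p \<in> fst d" "x = snd c p" by auto
  show "\<exists>f'. (transition c d has_derivative f') (at x) \<and> (\<forall>v. f' (\<i> *s v) = \<i> *s f' v)"
    using has_derivative_transition[OF assms p(1,2)] mult_i_simps(4) unfolding p(3) mult_i_def by metis
qed

lemma has_derivative_change_chart:
  assumes "c \<in> A" "d \<in> A" "p \<in> fst c" "p \<in> fst d"
    and h: "((\<lambda>x. h (chart_inv c x)) has_derivative F) (at (snd c p))"
  shows "((\<lambda>x. h (chart_inv d x)) has_derivative (\<lambda>v. F ((norm (snd c p) / norm (snd d p)) *\<^sub>R v))) (at (snd d p))"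
proof -
  obtain r N where *: "r > 0" "open N" "snd c p \<in> N" "norm (snd d p) / norm (snd c p) = r"
    "snd d p = r *\<^sub>R snd c p"
    "\<And>y. y \<in> N \<Longrightarrow> chart_inv d (r *\<^sub>R y) = chart_inv c y"
    by (rule homothetyE[OF assms(1-4)]) blast
  have r: "norm (snd c p) / norm (snd d p) = inverse r" using *(4) by (metis inverse_divide)
  have "((\<lambda>x. inverse r *\<^sub>R x) has_derivative (\<lambda>v. inverse r *\<^sub>R v)) (at (snd d p))"
    by (intro derivative_intros)
  moreover have "inverse r *\<^sub>R snd d p = snd c p" using * by simp
  ultimately have "((\<lambda>x. h (chart_inv c (inverse r *\<^sub>R x))) has_derivative (\<lambda>v. F (inverse r *\<^sub>R v))) (at (snd d p))"
    using has_derivative_compose[of "\<lambda>x. inverse r *\<^sub>R x" _ "snd d p" UNIV "\<lambda>x. h (chart_inv c x)" F] h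
    by simp
  moreover have "open ((\<lambda>x. inverse r *\<^sub>R x) -` N)"
    using *(2) by (intro open_vimage continuous_intros)
  moreover have "snd d p \<in> (\<lambda>x. inverse r *\<^sub>R x) -` N" using * by simp
  moreover have "h (chart_inv c (inverse r *\<^sub>R x)) = h (chart_inv d x)" if "x \<in> (\<lambda>x. inverse r *\<^sub>R x) -` N" for x
    using *(6)[of "inverse r *\<^sub>R x"] *(1) that by simp
  ultimately show ?thesis
    unfolding r by (rule has_derivative_transform_within_open)
qed

lemma tangent_change_chart:
  assumes "u \<in> tangent_space A p" "c \<in> A" "d \<in> A" "p \<in> fst c" "p \<in> fst d"
  shows "u d = (norm (snd d p) / norm (snd c p)) *\<^sub>R u c"
  using assms unfolding tangent_space_iff by blast

lemma tangent_outside: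
  "u \<in> tangent_space A p \<Longrightarrow> \<not> (c \<in> A \<and> p \<in> fst c) \<Longrightarrow> u c = 0"
  unfolding tangent_space_def by blast

lemma tangent_spaceI:
  assumes "\<And>c. \<not> (c \<in> A \<and> p \<in> fst c) \<Longrightarrow> u c = 0"
    and "\<And>c d. c \<in> A \<Longrightarrow> d \<in> A \<Longrightarrow> p \<in> fst c \<Longrightarrow> p \<in> fst d \<Longrightarrow>
      u d = (norm (snd d p) / norm (snd c p)) *\<^sub>R u c"
  shows "u \<in> tangent_space A p"
  unfolding tangent_space_iff using assms by blast

lemma tangent_linear:
  assumes "u \<in> tangent_space A p" "linear f"
  shows "(\<lambda>c. f (u c)) \<in> tangent_space A p"
  by (rule tangent_spaceI)
    (metis tangent_outside[OF assms(1)] linear_0[OF assms(2)],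
     metis tangent_change_chart[OF assms(1)] linear_cmul[OF assms(2)])

lemma tangent_add:
  assumes "u \<in> tangent_space A p" "v \<in> tangent_space A p"
  shows "u + v \<in> tangent_space A p"
proof (rule tangent_spaceI)
  show "(u + v) c = 0" if "\<not> (c \<in> A \<and> p \<in> fst c)" for c
    using tangent_outside[OF assms(1) that] tangent_outside[OF assms(2) that] by simp
  show "(u + v) d = (norm (snd d p) / norm (snd c p)) *\<^sub>R (u + v) c"
    if "c \<in> A" "d \<in> A" "p \<in> fst c" "p \<in> fst d" for c d
    using tangent_change_chart[OF assms(1) that] tangent_change_chart[OF assms(2) that]
    by (simp add: scaleR_add_right)
qed

lemma tangent_scale: "u \<in> tangent_space A p \<Longrightarrow> scale_tvec r u \<in> tangent_space A p"
  unfolding scale_tvec_def by (rule tangent_linear) (simp_all add: linear_iff algebra_simps)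

lemma tangent_diff:
  assumes "u \<in> tangent_space A p" "v \<in> tangent_space A p"
  shows "u - v \<in> tangent_space A p"
proof -
  have "u - v = u + scale_tvec (- 1) v" by (simp add: fun_eq_iff scale_tvec_def)
  then show ?thesis using tangent_add[OF assms(1) tangent_scale[OF assms(2)]] by metis
qed

lemma tangent_J: "u \<in> tangent_space A p \<Longrightarrow> J_tvec u \<in> tangent_space A p"
  unfolding J_tvec_def mult_i_def[symmetric] by (rule tangent_linear) (simp_all add: linear_iff)

text \<open>Makes \<open>vf_apply\<close> computable in any chart: the factor in the components of
  \<open>X p\<close> cancels the one from the chain rule.\<close>

lemma vf_apply_eq:
  assumes X: "X p \<in> tangent_space A p" and c: "c \<in> A" "p \<in> fst c"
    and f: "((\<lambda>x. f (chart_inv c x)) has_derivative F) (at (snd c p))"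
  shows "vf_apply A X f p = F (X p c)"
proof -
  define d where "d = (SOME d. d \<in> A \<and> p \<in> fst d)"
  have d: "d \<in> A" "p \<in> fst d" using someI[of "\<lambda>d. d \<in> A \<and> p \<in> fst d" c] c by (auto simp: d_def)
  have "vf_apply A X f p = frechet_derivative (\<lambda>x. f (chart_inv d x)) (at (snd d p)) (X p d)"
    by (simp add: vf_apply_def d_def Let_def comp_def)
  also have "\<dots> = F ((norm (snd c p) / norm (snd d p)) *\<^sub>R X p d)"
    using frechet_derivative_eqI[OF has_derivative_change_chart[OF c(1) d(1) c(2) d(2) f]] by simp
  also have "(norm (snd c p) / norm (snd d p)) *\<^sub>R X p d = X p c"
    using tangent_change_chart[OF X d(1) c(1) d(2) c(2)] by simp
  finally show ?thesis .
qed

text \<open>Scaling by r multiplies both the product of the components and |z|^2 by r^2, so the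
  chart picked in \<open>atlas_metric\<close> does not matter.\<close>

lemma atlas_metric_eq:
  assumes u: "u \<in> tangent_space A p" and v: "v \<in> tangent_space A p" and c: "c \<in> A" "p \<in> fst c"
  shows "atlas_metric A p u v = inverse (snd c p \<bullet> snd c p) * (u c \<bullet> v c)"
proof -
  define d where "d = (SOME d. d \<in> A \<and> p \<in> fst d)"
  have d: "d \<in> A" "p \<in> fst d" using someI[of "\<lambda>d. d \<in> A \<and> p \<in> fst d" c] c by (auto simp: d_def)
  have "snd c p \<noteq> 0" "snd d p \<noteq> 0" using coord_nonzero c d by auto
  then show ?thesis
    using tangent_change_chart[OF u c(1) d(1) c(2) d(2)] tangent_change_chart[OF v c(1) d(1) c(2) d(2)]
    by (simp add: atlas_metric_def d_def[symmetric] Let_def dot_square_norm power2_eq_square field_simps)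
qed

lemma vfD:
  assumes "X \<in> vector_fields A"
  shows "X p \<in> tangent_space A p"
    and "\<not> (c \<in> A \<and> p \<in> fst c) \<Longrightarrow> X p c = 0"
    and "c \<in> A \<Longrightarrow> smooth_on (local_rep X c) (snd c ` fst c)"
proof -
  show T: "X p \<in> tangent_space A p" using assms unfolding vector_fields_def by blast
  show "X p c = 0" if "\<not> (c \<in> A \<and> p \<in> fst c)" using tangent_outside[OF T that] .
  show "smooth_on (local_rep X c) (snd c ` fst c)" if "c \<in> A" using assms that unfolding vector_fields_def by blast
qed

lemma local_rep_coord: "c \<in> A \<Longrightarrow> p \<in> fst c \<Longrightarrow> local_rep X c (snd c p) = X p c"
  by (simp add: local_rep_def chart_inv_coord)

lemma vf_has_derivative:
  assumes "X \<in> vector_fields A" "c \<in> A" "p \<in> fst c"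
  shows "(local_rep X c has_derivative frechet_derivative (local_rep X c) (at (snd c p))) (at (snd c p))"
  using smooth_on_has_derivative[OF vfD(3)[OF assms(1,2)]] assms(3) by blast

text \<open>Near \<open>snd c p\<close> the representations satisfy X_d(r y) = r X_c(y) with
  constant r. Differentiating this produces no second derivative of the coordinate change.\<close>

lemma vf_change_chart:
  assumes X: "X \<in> vector_fields A" and cd: "c \<in> A" "d \<in> A" "p \<in> fst c" "p \<in> fst d"
  shows "frechet_derivative (local_rep X d) (at (snd d p)) ((norm (snd d p) / norm (snd c p)) *\<^sub>R v)
    = (norm (snd d p) / norm (snd c p)) *\<^sub>R frechet_derivative (local_rep X c) (at (snd c p)) v"
proof -
  obtain r N where *: "r > 0" "open N" "snd c p \<in> N" "N \<subseteq> snd c ` fst c" "norm (snd d p) / norm (snd c p) = r"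
    "\<And>y. y \<in> N \<Longrightarrow> chart_inv c y \<in> fst d"
    "\<And>y. y \<in> N \<Longrightarrow> snd d (chart_inv c y) = r *\<^sub>R y"
    by (rule homothetyE[OF cd]) blast
  have 1: "((\<lambda>x. r *\<^sub>R local_rep X c x) has_derivative
      (\<lambda>v. r *\<^sub>R frechet_derivative (local_rep X c) (at (snd c p)) v)) (at (snd c p))"
    by (intro has_derivative_scaleR_right vf_has_derivative X cd)
  have 2: "((\<lambda>x. X (chart_inv c x) d) has_derivative
      (\<lambda>v. r *\<^sub>R frechet_derivative (local_rep X c) (at (snd c p)) v)) (at (snd c p))"
  proof (rule has_derivative_transform_within_open[OF 1 *(2,3)])
    fix y assume y: "y \<in> N"
    then have yc: "y \<in> snd c ` fst c" using *(4) by blast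
    then have "y \<noteq> 0" using zero_notin_image[OF cd(1)] by blast
    then have "norm (snd d (chart_inv c y)) / norm (snd c (chart_inv c y)) = r"
      using *(1) *(7)[OF y] coord_chart_inv[OF yc] by simp
    then show "r *\<^sub>R local_rep X c y = X (chart_inv c y) d"
      using tangent_change_chart[OF vfD(1)[OF X] cd(1,2) chart_inv_in[OF yc] *(6)[OF y]]
      by (simp add: local_rep_def)
  qed
  have "norm (snd c p) / norm (snd d p) * r = 1"
    using coord_nonzero cd by (simp add: *(5)[symmetric])
  then show ?thesis
    using frechet_derivative_eqI[OF has_derivative_change_chart[OF cd 2]]
    unfolding *(5) local_rep_def by (simp del: divide_eq_1_iff times_divide_eq_left)
qed

section \<open>The connections on the manifold\<close>

lemma cov_coord:
  assumes "c \<in> A" "p \<in> fst c"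
  shows "cov \<alpha> \<beta> \<delta> (local_rep X c) (local_rep Y c) (snd c p) =
    frechet_derivative (local_rep Y c) (at (snd c p)) (X p c)
    - inverse (snd c p \<bullet> snd c p) *\<^sub>R gform \<alpha> \<beta> \<delta> (snd c p) (X p c) (Y p c)"
  using assms by (simp add: cov_def local_rep_coord)

lemma local_rep_atlas_conn:
  "c \<in> A \<Longrightarrow> x \<in> snd c ` fst c \<Longrightarrow>
    local_rep (atlas_conn A \<alpha> \<beta> \<delta> X Y) c x = cov \<alpha> \<beta> \<delta> (local_rep X c) (local_rep Y c) x"
  by (subst local_rep_def) (simp add: atlas_conn_def chart_inv_in coord_chart_inv)

text \<open>Under a scaling by r the trilinear \<open>gform\<close> gains r^3 and 1/|x|^2 gains
  r^(-2); the resulting factor r is also that of the derivative term, by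
  \<open>vf_change_chart\<close>.\<close>

lemma atlas_conn_vector_field:
  assumes X: "X \<in> vector_fields A" and Y: "Y \<in> vector_fields A"
  shows "atlas_conn A \<alpha> \<beta> \<delta> X Y \<in> vector_fields A"
proof -
  have "atlas_conn A \<alpha> \<beta> \<delta> X Y p \<in> tangent_space A p" for p
    unfolding tangent_space_iff
  proof (intro conjI ballI impI allI)
    fix c d assume cd: "c \<in> A" "d \<in> A" "p \<in> fst c \<inter> fst d"
    have cd': "p \<in> fst c" "p \<in> fst d" using cd by auto
    obtain r' where r': "r' > 0" "snd d p = r' *\<^sub>R snd c p" "norm (snd d p) / norm (snd c p) = r'"
      by (rule homothetyE[OF cd(1,2) cd']) blast
    have Xd: "X p d = r' *\<^sub>R X p c" and Yd: "Y p d = r' *\<^sub>R Y p c"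
      using tangent_change_chart[OF vfD(1)[OF X] cd(1,2) cd'] tangent_change_chart[OF vfD(1)[OF Y] cd(1,2) cd'] r'(3)
      by simp_all
    show "atlas_conn A \<alpha> \<beta> \<delta> X Y p d = (norm (snd d p) / norm (snd c p)) *\<^sub>R atlas_conn A \<alpha> \<beta> \<delta> X Y p c"
      using cd(1,2) cd' vf_change_chart[OF Y cd(1,2) cd', of "X p c"] r'(1) unfolding r'(3)
      by (simp add: atlas_conn_def cov_coord Xd Yd) (simp add: r'(2) gform_scaleR scaleR_diff_right field_simps)
  qed (auto simp: atlas_conn_def)
  moreover have "smooth_on (local_rep (atlas_conn A \<alpha> \<beta> \<delta> X Y) c) (snd c ` fst c)" if c: "c \<in> A" for c
    by (rule smooth_on_cong[OF open_image[OF c] smooth_on_cov[OF open_image[OF c] zero_notin_image[OF c]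
            vfD(3)[OF X c] vfD(3)[OF Y c]]])
      (simp add: local_rep_atlas_conn c)
  ultimately show ?thesis by (simp add: vector_fields_def)
qed

lemma J_vf_eq: "J_vf X p c = mult_i (X p c)"
  by (simp add: J_vf_def J_tvec_def mult_i_def)

lemma local_rep_J_vf: "local_rep (J_vf X) c = (\<lambda>x. mult_i (local_rep X c x))"
  by (simp add: local_rep_def J_vf_eq)

lemma J_vf_vector_field:
  assumes X: "X \<in> vector_fields A"
  shows "J_vf X \<in> vector_fields A"
proof -
  have "J_vf X p \<in> tangent_space A p" for p
    using tangent_J[OF vfD(1)[OF X]] by (simp add: J_vf_def)
  moreover have "smooth_on (local_rep (J_vf X) c) (snd c ` fst c)" if "c \<in> A" for c
    unfolding local_rep_J_vf
    by (intro smooth_on_bounded_linear[OF bounded_linear_mult_i] open_image vfD(3)[OF X] that)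
  ultimately show ?thesis by (simp add: vector_fields_def)
qed

lemma affine_atlas_conn: "affine_connection A (atlas_conn A \<alpha> \<beta> \<delta>)"
  unfolding affine_connection_def
proof (intro conjI ballI allI impI)
  let ?D = "atlas_conn A \<alpha> \<beta> \<delta>"
  fix X Y assume X: "X \<in> vector_fields A" and Y: "Y \<in> vector_fields A"
  show "?D X Y \<in> vector_fields A" using atlas_conn_vector_field X Y .
  have lin: "linear (frechet_derivative (local_rep Z c) (at (snd c p)))"
    if "Z \<in> vector_fields A" "c \<in> A" "p \<in> fst c" for Z c p
    using vf_has_derivative[OF that] has_derivative_linear by blast
  {
    fix Z assume Z: "Z \<in> vector_fields A"
    show "?D (X + Y) Z = ?D X Z + ?D Y Z"
      by (intro ext) (auto simp: atlas_conn_def cov_coord linear_add[OF lin[OF Z]] gform_add algebra_simps)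
    have "frechet_derivative (local_rep (Y + Z) c) (at (snd c p)) v =
        frechet_derivative (local_rep Y c) (at (snd c p)) v + frechet_derivative (local_rep Z c) (at (snd c p)) v"
      if "c \<in> A" "p \<in> fst c" for c p v
      using frechet_derivative_eqI[OF has_derivative_add[OF vf_has_derivative[OF Y that] vf_has_derivative[OF Z that]]]
      by (simp add: local_rep_def)
    then show "?D X (Y + Z) = ?D X Y + ?D X Z"
      by (intro ext) (auto simp: atlas_conn_def cov_coord gform_add algebra_simps)
  next
    fix f assume f: "smooth_function A f"
    show "?D (scale_vf f X) Y = scale_vf f (?D X Y)"
      by (intro ext) (auto simp: scale_vf_def scale_tvec_def atlas_conn_def cov_coord
          linear_cmul[OF lin[OF Y]] gform_scaleR algebra_simps)
    have "?D X (scale_vf f Y) p c = (scale_vf (vf_apply A X f) Y + scale_vf f (?D X Y)) p c" for p c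
    proof (cases "c \<in> A \<and> p \<in> fst c")
      case False
      then show ?thesis using vfD(2)[OF Y] by (auto simp: atlas_conn_def scale_vf_def scale_tvec_def)
    next
      case True
      then have c: "c \<in> A" "p \<in> fst c" by auto
      define F where "F = frechet_derivative (\<lambda>x. f (chart_inv c x)) (at (snd c p))"
      have F: "((\<lambda>x. f (chart_inv c x)) has_derivative F) (at (snd c p))"
        unfolding F_def
        by (rule smooth_on_has_derivative[of _ "snd c ` fst c"])
          (use f c in \<open>auto simp: smooth_function_def comp_def\<close>)
      have "local_rep (scale_vf f Y) c = (\<lambda>x. f (chart_inv c x) *\<^sub>R local_rep Y c x)"
        by (simp add: local_rep_def scale_vf_def scale_tvec_def)
      then have "frechet_derivative (local_rep (scale_vf f Y) c) (at (snd c p)) =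
          (\<lambda>v. f p *\<^sub>R frechet_derivative (local_rep Y c) (at (snd c p)) v + F v *\<^sub>R Y p c)"
        using frechet_derivative_eqI[OF has_derivative_scaleR[OF F vf_has_derivative[OF Y c]]] c
        by (simp add: chart_inv_coord local_rep_coord)
      then show ?thesis
        using c vf_apply_eq[where X = X and p = p and f = f, OF vfD(1)[OF X] c F]
        by (simp add: atlas_conn_def cov_coord scale_vf_def scale_tvec_def gform_scaleR algebra_simps)
    qed
    then show "?D X (scale_vf f Y) = scale_vf (vf_apply A X f) Y + scale_vf f (?D X Y)"
      by (intro ext)
  }
qed

lemma metric_atlas_conn: "metric_connection A (atlas_metric A) (atlas_conn A \<alpha> \<beta> \<delta>)"
  unfolding metric_connection_def
proof (intro conjI ballI affine_atlas_conn)
  let ?D = "atlas_conn A \<alpha> \<beta> \<delta>"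
  fix X Y Z p
  assume X: "X \<in> vector_fields A" and Y: "Y \<in> vector_fields A" and Z: "Z \<in> vector_fields A"
    and "p \<in> (\<Union>c\<in>A. fst c)"
  then obtain c where c: "c \<in> A" "p \<in> fst c" by blast
  let ?x = "snd c p" and ?Y = "local_rep Y c" and ?Z = "local_rep Z c"
  have x: "?x \<noteq> 0" "?x \<in> snd c ` fst c" using coord_nonzero c by auto
  have "((\<lambda>y. inverse (y \<bullet> y)) has_derivative (\<lambda>h. - (2 * (?x \<bullet> h) * (inverse (?x \<bullet> ?x))\<^sup>2))) (at ?x)"
    using x by (auto intro!: derivative_eq_intros simp: inner_commute power2_eq_square algebra_simps)
  note d = has_derivative_mult[OF this has_derivative_inner[OF vf_has_derivative[OF Y c] vf_has_derivative[OF Z c]]]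
  have e: "atlas_metric A (chart_inv c y) (Y (chart_inv c y)) (Z (chart_inv c y)) = inverse (y \<bullet> y) * (?Y y \<bullet> ?Z y)"
    if "y \<in> snd c ` fst c" for y
    using atlas_metric_eq[OF vfD(1)[OF Y] vfD(1)[OF Z] c(1) chart_inv_in[OF that]]
    by (simp add: coord_chart_inv[OF that] local_rep_def)
  have "((\<lambda>y. atlas_metric A (chart_inv c y) (Y (chart_inv c y)) (Z (chart_inv c y))) has_derivative
     (\<lambda>h. inverse (?x \<bullet> ?x) * (?Y ?x \<bullet> frechet_derivative ?Z (at ?x) h + frechet_derivative ?Y (at ?x) h \<bullet> ?Z ?x)
       + - (2 * (?x \<bullet> h) * (inverse (?x \<bullet> ?x))\<^sup>2) * (?Y ?x \<bullet> ?Z ?x))) (at ?x)"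
    by (rule has_derivative_transform_within_open[OF d open_image[OF c(1)] x(2)]) (simp add: e)
  note v = vf_apply_eq[where X = X and p = p and f = "\<lambda>q. atlas_metric A q (Y q) (Z q)", OF vfD(1)[OF X] c this]
  \<comment> \<open>The left-hand side comes from differentiating 1/|x|^2; \<open>gform_skew\<close>
    distributes it over the two connection terms.\<close>
  have s': "2 * (?x \<bullet> X p c) * (Y p c \<bullet> Z p c) =
      gform \<alpha> \<beta> \<delta> ?x (X p c) (Y p c) \<bullet> Z p c + Y p c \<bullet> gform \<alpha> \<beta> \<delta> ?x (X p c) (Z p c)"
    by (simp add: gform_skew)
  have s: "(2 * (?x \<bullet> X p c) * (inverse (?x \<bullet> ?x))\<^sup>2) * (Y p c \<bullet> Z p c) =
      (inverse (?x \<bullet> ?x))\<^sup>2 * (gform \<alpha> \<beta> \<delta> ?x (X p c) (Y p c) \<bullet> Z p c + Y p c \<bullet> gform \<alpha> \<beta> \<delta> ?x (X p c) (Z p c))"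
    using arg_cong[OF s', of "(*) ((inverse (?x \<bullet> ?x))\<^sup>2)"] by (simp only: mult_ac)
  show "vf_apply A X (\<lambda>q. atlas_metric A q (Y q) (Z q)) p =
      atlas_metric A p (?D X Y p) (Z p) + atlas_metric A p (Y p) (?D X Z p)"
    using atlas_metric_eq[OF vfD(1)[OF atlas_conn_vector_field[OF X Y]] vfD(1)[OF Z] c]
      atlas_metric_eq[OF vfD(1)[OF Y] vfD(1)[OF atlas_conn_vector_field[OF X Z]] c] c s
    by (simp add: v local_rep_coord atlas_conn_def cov_coord inner_simps power2_eq_square algebra_simps)
qed

lemma torsion_atlas_conn:
  assumes "c \<in> A" "p \<in> fst c"
  shows "torsion A (atlas_conn A \<alpha> \<beta> \<delta>) X Y p c =
    inverse (snd c p \<bullet> snd c p) *\<^sub>R (gform \<alpha> \<beta> \<delta> (snd c p) (Y p c) (X p c) - gform \<alpha> \<beta> \<delta> (snd c p) (X p c) (Y p c))"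
  using assms by (simp add: torsion_def atlas_conn_def lie_bracket_def cov_coord algebra_simps)

lemma torsion_outside: "\<not> (c \<in> A \<and> p \<in> fst c) \<Longrightarrow> torsion A (atlas_conn A \<alpha> \<beta> \<delta>) X Y p c = 0"
  by (auto simp: torsion_def atlas_conn_def lie_bracket_def)

text \<open>\<open>gform 0 1 0 x u v\<close> is symmetric in \<open>u\<close> and \<open>v\<close>,
  so the torsion vanishes. It is the usual correction term for the conformal change from |dz|^2 to
  |dz|^2 / |z|^2.\<close>

lemma levi_civita_atlas_conn: "levi_civita_connection A (atlas_metric A) (atlas_conn A 0 1 0)"
  unfolding levi_civita_connection_def
proof (intro conjI ballI metric_atlas_conn ext)
  fix X Y p c
  show "torsion A (atlas_conn A 0 1 0) X Y p c = 0 p c"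
    by (cases "c \<in> A \<and> p \<in> fst c")
      (simp_all add: torsion_atlas_conn torsion_outside gform_def inner_commute[of "Y p c" "X p c"])
qed

text \<open>Torsion-freeness writes the bracket as a difference of two covariant derivatives, whose
  behaviour under coordinate changes is already known.\<close>

lemma lie_bracket_vector_field:
  assumes X: "X \<in> vector_fields A" and Y: "Y \<in> vector_fields A"
  shows "lie_bracket A X Y \<in> vector_fields A"
proof -
  let ?D = "atlas_conn A 0 1 0"
  have "torsion A ?D X Y = 0"
    using levi_civita_atlas_conn X Y unfolding levi_civita_connection_def by blast
  then have eq: "lie_bracket A X Y = ?D X Y - ?D Y X"
    unfolding torsion_def by (metis eq_iff_diff_eq_0)
  note D = atlas_conn_vector_field[OF X Y, of 0 1 0] atlas_conn_vector_field[OF Y X, of 0 1 0]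
  have "(?D X Y - ?D Y X) p \<in> tangent_space A p" for p
    using tangent_diff[OF vfD(1)[OF D(1)] vfD(1)[OF D(2)]] by simp
  moreover have "smooth_on (local_rep (?D X Y - ?D Y X) c) (snd c ` fst c)" if "c \<in> A" for c
    using smooth_on_diff[OF open_image[OF that] vfD(3)[OF D(1) that] vfD(3)[OF D(2) that]]
    by (simp add: local_rep_def[abs_def])
  ultimately show ?thesis by (simp add: eq vector_fields_def)
qed

lemma frechet_derivative_J_vf:
  assumes "Y \<in> vector_fields A" "c \<in> A" "p \<in> fst c"
  shows "frechet_derivative (local_rep (J_vf Y) c) (at (snd c p)) v =
    mult_i (frechet_derivative (local_rep Y c) (at (snd c p)) v)"
  using frechet_derivative_eqI[OF has_derivative_mult_i[OF vf_has_derivative[OF assms]]]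
  by (simp add: local_rep_J_vf)

text \<open>\<open>gform 1 0 0 x u v\<close> is the Hermitian product of u and x, linear in u, times
  \<open>v\<close>. Being complex bilinear in u and v it commutes with J, and the torsion T
  satisfies T(JX, JY) = -T(X, Y).\<close>

lemma chern_atlas_conn: "chern_connection A (atlas_metric A) (atlas_conn A 1 0 0)"
  unfolding chern_connection_def
proof (intro conjI ballI metric_atlas_conn ext)
  fix X Y p c
  assume "X \<in> vector_fields A" and Y: "Y \<in> vector_fields A"
  show "atlas_conn A 1 0 0 X (J_vf Y) p c = J_vf (atlas_conn A 1 0 0 X Y) p c"
    by (auto simp: atlas_conn_def J_vf_eq cov_coord frechet_derivative_J_vf[OF Y] gform_def)
  show "torsion_1_1 A (atlas_conn A 1 0 0) X Y p c = 0 p c"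
    by (cases "c \<in> A \<and> p \<in> fst c")
      (simp_all add: torsion_1_1_def scale_vf_def scale_tvec_def torsion_atlas_conn torsion_outside gform_def
        J_vf_eq inner_mult_i_right algebra_simps)
qed

lemma gauduchon_atlas_conn:
  "gauduchon_connection A (atlas_metric A) (1 - 2 * s) (atlas_conn A (1 - 2 * s) s s)"
  unfolding gauduchon_connection_def
proof (rule exI[of _ "atlas_conn A 0 1 0"], rule exI[of _ "atlas_conn A 1 0 0"],
    intro conjI ballI levi_civita_atlas_conn chern_atlas_conn ext)
  fix X Y p c
  assume "X \<in> vector_fields A" and Y: "Y \<in> vector_fields A"
  show "atlas_conn A (1 - 2 * s) s s X Y p c =
      (scale_vf (\<lambda>_. 1 - 2 * s) (atlas_conn A 1 0 0 X Y)
        + scale_vf (\<lambda>_. 1 - (1 - 2 * s)) (lichnerowicz (atlas_conn A 0 1 0) X Y)) p c"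
  proof (cases "c \<in> A \<and> p \<in> fst c")
    case True
    define v where "v = frechet_derivative (local_rep Y c) (at (snd c p)) (X p c)"
    show ?thesis
      using True
      by (simp add: atlas_conn_def lichnerowicz_def scale_vf_def scale_tvec_def J_vf_eq cov_coord
          frechet_derivative_J_vf[OF Y] v_def[symmetric] gform_gauduchon)
        (simp add: vec_numeral_mult algebra_simps)
  next
    case False
    then show ?thesis
      by (auto simp: atlas_conn_def lichnerowicz_def scale_vf_def scale_tvec_def J_vf_eq)
  qed
qed

section \<open>Curvature on the manifold\<close>

lemma curvature_atlas_conn:
  assumes X: "X \<in> vector_fields A" and Y: "Y \<in> vector_fields A" and Z: "Z \<in> vector_fields A"
    and c: "c \<in> A" "p \<in> fst c"
  shows "curvature A (atlas_conn A \<alpha> \<beta> \<delta>) X Y Z p c = curv_form \<alpha> \<beta> \<delta> (snd c p) (X p c) (Y p c) (Z p c)"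
proof -
  let ?x = "snd c p" and ?D = "atlas_conn A \<alpha> \<beta> \<delta>" and ?B = "lie_bracket A X Y"
  have x: "?x \<in> snd c ` fst c" using c by blast
  \<comment> \<open>The two functions agree only on the chart image; that it is open suffices for
    their derivatives.\<close>
  have L: "frechet_derivative (local_rep (?D W Z) c) (at ?x) =
      frechet_derivative (cov \<alpha> \<beta> \<delta> (local_rep W c) (local_rep Z c)) (at ?x)" for W
    by (rule frechet_derivative_cong_open[OF open_image[OF c(1)] x]) (rule local_rep_atlas_conn[OF c(1)])
  have cov_eq: "cov \<alpha> \<beta> \<delta> (local_rep V c) (local_rep (?D W Z) c) ?x =
      cov \<alpha> \<beta> \<delta> (local_rep V c) (cov \<alpha> \<beta> \<delta> (local_rep W c) (local_rep Z c)) ?x" for V W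
    by (simp only: cov_def[of _ _ _ "local_rep V c"] L local_rep_atlas_conn[OF c(1) x])
  have B: "local_rep ?B c ?x = frechet_derivative (local_rep Y c) (at ?x) (local_rep X c ?x)
      - frechet_derivative (local_rep X c) (at ?x) (local_rep Y c ?x)"
    using c by (simp add: local_rep_coord lie_bracket_def)
  show ?thesis
    using cov_curvature[where B = "local_rep ?B c", OF open_image[OF c(1)] zero_notin_image[OF c(1)] x vfD(3)[OF X c(1)] vfD(3)[OF Y c(1)]
        vfD(3)[OF Z c(1)] B, of \<alpha> \<beta> \<delta>] c
    by (simp add: curvature_def atlas_conn_def[of A \<alpha> \<beta> \<delta> _ "?D _ _"] atlas_conn_def[of A \<alpha> \<beta> \<delta> ?B] cov_eq local_rep_coord)
qed

lemma zero_hol_sect_curv_atlas_conn: "zero_hol_sect_curv A (atlas_metric A) (atlas_conn A 3 (-1) (-1))"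
  unfolding zero_hol_sect_curv_def
proof (intro ballI impI)
  let ?D = "atlas_conn A 3 (-1) (-1)"
  fix X p assume X: "X \<in> vector_fields A" and "p \<in> (\<Union>c\<in>A. fst c)"
  then obtain c where c: "c \<in> A" "p \<in> fst c" by blast
  note JX = J_vf_vector_field[OF X]
  note D = atlas_conn_vector_field
  \<comment> \<open>\<open>atlas_metric\<close> evaluates in a chosen chart; passing to
    \<open>c\<close> requires both arguments to be tangent vectors.\<close>
  have "curvature A ?D X (J_vf X) (J_vf X) p \<in> tangent_space A p"
    using tangent_diff[OF tangent_diff[OF vfD(1)[OF D[OF X D[OF JX JX]]] vfD(1)[OF D[OF JX D[OF X JX]]]]
        vfD(1)[OF D[OF lie_bracket_vector_field[OF X JX] JX]]]
    by (simp add: curvature_def)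
  from atlas_metric_eq[OF this vfD(1)[OF X] c]
  have "curvature4 A (atlas_metric A) ?D X (J_vf X) (J_vf X) X p = 0"
    using curv_form_hol_sect[OF coord_nonzero[OF c], of "X p c"] curvature_atlas_conn[OF X JX JX c]
    by (simp add: curvature4_def J_vf_eq)
  then show "hol_sect_curv A (atlas_metric A) ?D X p = 0"
    by (simp add: hol_sect_curv_def)
qed

lemma hermitian_atlas_metric: "hermitian_metric A (atlas_metric A)"
  unfolding hermitian_metric_def
proof (intro conjI ballI allI impI)
  fix p assume "p \<in> (\<Union>c\<in>A. fst c)"
  then obtain c where c: "c \<in> A" "p \<in> fst c" by blast
  note eq = atlas_metric_eq[OF _ _ c]
  fix u assume u: "u \<in> tangent_space A p"
  {
    fix v assume v: "v \<in> tangent_space A p"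
    {
      fix w assume w: "w \<in> tangent_space A p"
      show "atlas_metric A p (u + v) w = atlas_metric A p u w + atlas_metric A p v w"
        unfolding eq[OF u w] eq[OF v w] eq[OF tangent_add[OF u v] w] by (simp add: inner_add_left distrib_left)
    }
    show "atlas_metric A p u v = atlas_metric A p v u"
      unfolding eq[OF u v] eq[OF v u] by (simp add: inner_commute[of "u c"])
    show "atlas_metric A p (J_tvec u) (J_tvec v) = atlas_metric A p u v"
      unfolding eq[OF u v] eq[OF tangent_J[OF u] tangent_J[OF v]]
      by (simp add: J_tvec_def mult_i_def[symmetric])
    fix r
    show "atlas_metric A p (scale_tvec r u) v = r * atlas_metric A p u v"
      unfolding eq[OF u v] eq[OF tangent_scale[OF u] v] by (simp add: scale_tvec_def)
  }
  assume "u \<noteq> 0"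
  then obtain d where "u d \<noteq> 0" by (auto simp: fun_eq_iff)
  then have "u c \<noteq> 0"
    using tangent_change_chart[OF u c(1) _ c(2), of d] tangent_outside[OF u, of d]
    by (cases "d \<in> A \<and> p \<in> fst d") auto
  then show "0 < atlas_metric A p u u"
    using eq[OF u u] coord_nonzero[OF c] by simp
next
  fix X Y assume X: "X \<in> vector_fields A" and Y: "Y \<in> vector_fields A"
  show "smooth_function A (\<lambda>p. atlas_metric A p (X p) (Y p))"
    unfolding smooth_function_def
  proof
    fix c assume c: "c \<in> A"
    note S = open_image[OF c]
    have "smooth_on (\<lambda>x. inverse (x \<bullet> x) *\<^sub>R (local_rep X c x \<bullet> local_rep Y c x)) (snd c ` fst c)"
      by (intro smooth_on_scaleR smooth_on_inverse smooth_on_inner smooth_on_id S vfD(3)[OF X c] vfD(3)[OF Y c])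
        (metis inner_eq_zero_iff zero_notin_image[OF c])
    then show "smooth_on ((\<lambda>p. atlas_metric A p (X p) (Y p)) \<circ> chart_inv c) (snd c ` fst c)"
    proof (rule smooth_on_cong[OF S])
      fix x assume x: "x \<in> snd c ` fst c"
      show "inverse (x \<bullet> x) *\<^sub>R (local_rep X c x \<bullet> local_rep Y c x) =
          ((\<lambda>p. atlas_metric A p (X p) (Y p)) \<circ> chart_inv c) x"
        using atlas_metric_eq[OF vfD(1)[OF X] vfD(1)[OF Y] c chart_inv_in[OF x]]
        by (simp add: coord_chart_inv[OF x] local_rep_def)
    qed
  qed
qed

section \<open>Global vector fields and non-flatness\<close>

definition linear_field :: "(complex^'n \<Rightarrow> complex^'n) \<Rightarrow> ('a, 'n) vfield" where
  "linear_field f = (\<lambda>p c. if c \<in> A \<and> p \<in> fst c then f (snd c p) else 0)"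

text \<open>f(r x) = r f(x) is the transformation law of a tangent vector under a homothety, so the
  field is consistent on all charts. Constant coordinate fields would not be.\<close>

lemma linear_field_vector_field:
  assumes f: "linear f"
  shows "linear_field f \<in> vector_fields A"
proof -
  have "linear_field f p \<in> tangent_space A p" for p
    unfolding tangent_space_iff
  proof (intro conjI ballI impI allI)
    fix c d assume cd: "c \<in> A" "d \<in> A" "p \<in> fst c \<inter> fst d"
    then obtain r where "snd d p = r *\<^sub>R snd c p" "norm (snd d p) / norm (snd c p) = r"
      using homothetyE by (metis IntD1 IntD2)
    then show "linear_field f p d = (norm (snd d p) / norm (snd c p)) *\<^sub>R linear_field f p c"
      using cd by (simp add: linear_field_def linear_cmul[OF f])
  qed (auto simp: linear_field_def)
  moreover have "smooth_on (local_rep (linear_field f) c) (snd c ` fst c)" if c: "c \<in> A" for c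
    by (rule smooth_on_cong[OF open_image[OF c] smooth_on_bounded_linear[OF _ open_image[OF c] smooth_on_id]])
      (use f c in \<open>auto simp: linear_conv_bounded_linear local_rep_def linear_field_def chart_inv_in coord_chart_inv\<close>)
  ultimately show ?thesis by (simp add: vector_fields_def)
qed

text \<open>The field of \<open>f\<close>, its image under J and the radial field realise the
  arguments of \<open>curv_form_nonzero\<close> at \<open>p\<close> by global fields.\<close>

lemma not_flat_atlas_conn:
  assumes c: "c \<in> A" "p \<in> fst c" and f: "linear f"
    and x: "snd c p \<bullet> snd c p = 1" "f (snd c p) \<bullet> f (snd c p) = 1"
      "snd c p \<bullet> f (snd c p) = 0" "mult_i (snd c p) \<bullet> f (snd c p) = 0"
  shows "\<not> flat_connection A (atlas_conn A 3 (-1) (-1))"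
proof
  assume flat: "flat_connection A (atlas_conn A 3 (-1) (-1))"
  have X: "linear_field f \<in> vector_fields A" by (rule linear_field_vector_field[OF f])
  have Z: "linear_field (\<lambda>x. x) \<in> vector_fields A" by (rule linear_field_vector_field) (simp add: linear_iff)
  have "curvature A (atlas_conn A 3 (-1) (-1)) (linear_field f) (J_vf (linear_field f)) (linear_field (\<lambda>x. x)) p c = 0"
    using flat X J_vf_vector_field[OF X] Z by (simp add: flat_connection_def)
  then have "curv_form 3 (-1) (-1) (snd c p) (f (snd c p)) (mult_i (f (snd c p))) (snd c p) = 0"
    using curvature_atlas_conn[OF X J_vf_vector_field[OF X] Z c] c by (simp add: J_vf_eq linear_field_def)
  then show False using curv_form_nonzero[OF x] by simp
qed

end

section \<open>The Hopf surface\<close>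

text \<open>The quotient map of \<open>\<complex>\<^sup>2 - {0}\<close> by \<open>exp (2\<pi>)\<close>, with the quotient identified with \<open>S\<^sup>3 \<times> S\<^sup>1\<close>.\<close>

definition hopf_proj :: "complex^2 \<Rightarrow> (complex^2) \<times> complex" where
  "hopf_proj z = (z /\<^sub>R norm z, cis (ln (norm z)))"

text \<open>The exponent is the branch of the argument of \<open>snd p\<close> in
  \<open>{b - pi<..b + pi}\<close>; it recovers ln |z|, of which \<open>p\<close> determines only
  the class modulo 2 pi.\<close>

definition hopf_lift :: "real \<Rightarrow> (complex^2) \<times> complex \<Rightarrow> complex^2" where
  "hopf_lift b p = exp (b + Arg (snd p * cis (- b))) *\<^sub>R fst p"

definition hopf_annulus :: "real \<Rightarrow> (complex^2) set" where
  "hopf_annulus b = {z. exp (b - pi) < norm z \<and> norm z < exp (b + pi)}"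

definition hopf_chart :: "real \<Rightarrow> ((complex^2) \<times> complex, 2) chart" where
  "hopf_chart b = (hopf_proj ` hopf_annulus b, hopf_lift b)"

definition hopf_surface :: "((complex^2) \<times> complex) topology" where
  "hopf_surface = top_of_set (sphere 0 1 \<times> sphere 0 1)"

section \<open>The charts of the Hopf surface\<close>

lemma hopf_annulus_nonzero: "z \<in> hopf_annulus b \<Longrightarrow> z \<noteq> 0"
  by (auto simp: hopf_annulus_def)

lemma open_hopf_annulus: "open (hopf_annulus b)"
  unfolding hopf_annulus_def by (intro open_Collect_conj open_Collect_less continuous_intros)

lemma hopf_proj_in_surface: "z \<noteq> 0 \<Longrightarrow> hopf_proj z \<in> sphere 0 1 \<times> sphere 0 1"
  by (simp add: hopf_proj_def)

lemma hopf_lift_proj: "z \<in> hopf_annulus b \<Longrightarrow> hopf_lift b (hopf_proj z) = z"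
proof -
  assume z: "z \<in> hopf_annulus b"
  then have nz: "norm z > 0" using hopf_annulus_nonzero by auto
  have "ln (norm z) - b \<in> {-pi<..pi}"
    using z nz ln_less_cancel_iff[of "exp (b - pi)" "norm z"] ln_less_cancel_iff[of "norm z" "exp (b + pi)"]
    by (auto simp: hopf_annulus_def)
  then have "Arg (cis (ln (norm z)) * cis (- b)) = ln (norm z) - b"
    by (simp add: cis_mult Arg_cis)
  then show ?thesis using nz by (simp add: hopf_proj_def hopf_lift_def)
qed

lemma hopf_proj_lift: "p \<in> sphere 0 1 \<times> sphere 0 1 \<Longrightarrow> hopf_proj (hopf_lift b p) = p"
proof -
  assume p: "p \<in> sphere 0 1 \<times> sphere 0 1"
  obtain w u where wu: "p = (w, u)" "norm w = 1" "norm u = 1" using p by (cases p) auto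
  have "cis (Arg (u * cis (- b))) = u * cis (- b)"
    using wu by (subst cis_Arg) (auto simp: sgn_div_norm norm_mult)
  then have "cis (b + Arg (u * cis (- b))) = u"
    using wu by (simp add: cis_mult[symmetric] mult.left_commute) (simp add: cis_mult)
  then show ?thesis using wu by (simp add: hopf_proj_def hopf_lift_def)
qed

text \<open>Only the closed end Arg = pi of the branch falls outside the open annulus. It is
  attained on the negative real axis, and 0 cannot occur as \<open>snd p\<close> has norm 1.\<close>

lemma hopf_lift_in_annulus_iff:
  assumes "p \<in> sphere 0 1 \<times> sphere 0 1"
  shows "hopf_lift b p \<in> hopf_annulus b \<longleftrightarrow> snd p * cis (- b) \<notin> \<real>\<^sub>\<le>\<^sub>0"
proof -
  have "norm (hopf_lift b p) = exp (b + Arg (snd p * cis (- b)))"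
    using assms by (auto simp: hopf_lift_def)
  moreover have "snd p * cis (- b) \<noteq> 0" using assms by auto
  ultimately show ?thesis
    using mpi_less_Arg[of "snd p * cis (- b)"] Arg_le_pi[of "snd p * cis (- b)"]
      Arg_eq_pi[of "snd p * cis (- b)"]
    by (auto simp: hopf_annulus_def complex_nonpos_Reals_iff complex_eq_iff less_le)
qed

lemma hopf_chart_domain:
  "hopf_proj ` hopf_annulus b = {p \<in> sphere 0 1 \<times> sphere 0 1. snd p * cis (- b) \<notin> \<real>\<^sub>\<le>\<^sub>0}"
proof (intro set_eqI iffI)
  fix p :: "(complex^2) \<times> complex"
  assume "p \<in> hopf_proj ` hopf_annulus b"
  then obtain z where z: "z \<in> hopf_annulus b" "p = hopf_proj z" by blast
  then have p: "p \<in> sphere 0 1 \<times> sphere 0 1"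
    using hopf_proj_in_surface hopf_annulus_nonzero by blast
  then show "p \<in> {p \<in> sphere 0 1 \<times> sphere 0 1. snd p * cis (- b) \<notin> \<real>\<^sub>\<le>\<^sub>0}"
    using hopf_lift_in_annulus_iff[OF p, of b] z hopf_lift_proj by auto
next
  fix p :: "(complex^2) \<times> complex"
  assume "p \<in> {p \<in> sphere 0 1 \<times> sphere 0 1. snd p * cis (- b) \<notin> \<real>\<^sub>\<le>\<^sub>0}"
  then show "p \<in> hopf_proj ` hopf_annulus b"
    using hopf_lift_in_annulus_iff[of p b] hopf_proj_lift[of p b]
    by (intro image_eqI[of _ _ "hopf_lift b p"]) auto
qed

lemma snd_hopf_chart_image: "snd (hopf_chart b) ` fst (hopf_chart b) = hopf_annulus b"
  using hopf_lift_proj by (force simp: hopf_chart_def image_image)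

lemma inj_on_hopf_lift: "inj_on (hopf_lift b) (hopf_proj ` hopf_annulus b)"
  by (auto simp: inj_on_def hopf_lift_proj)

lemma chart_inv_hopf_chart: "z \<in> hopf_annulus b \<Longrightarrow> chart_inv (hopf_chart b) z = hopf_proj z"
  unfolding chart_inv_def hopf_chart_def fst_conv snd_conv
  using inv_into_f_f[OF inj_on_hopf_lift, of "hopf_proj z" b] by (simp add: hopf_lift_proj)

text \<open>One point whose projection is unchanged forces \<open>cis (ln r) = 1\<close>, so
  \<open>r\<close> is a power of exp (2 pi) and its scaling is a deck transformation.\<close>

lemma hopf_proj_scaleR:
  assumes "r > 0" "z \<noteq> 0" "w \<noteq> 0" "hopf_proj (r *\<^sub>R z) = hopf_proj z"
  shows "hopf_proj (r *\<^sub>R w) = hopf_proj w"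
proof -
  have "cis (ln (norm z)) * cis (ln r) = cis (ln (norm z)) * 1"
    using assms by (simp add: hopf_proj_def ln_mult cis_mult add.commute)
  then have "cis (ln r) = 1" by (simp only: mult_cancel_left) simp
  then show ?thesis
    using assms by (simp add: hopf_proj_def ln_mult cis_mult[symmetric])
qed

lemma hopf_proj_eq_imp_scaleR:
  assumes "z \<noteq> 0" "w \<noteq> 0" "hopf_proj z = hopf_proj w"
  shows "w = (norm w / norm z) *\<^sub>R z"
proof -
  have "z /\<^sub>R norm z = w /\<^sub>R norm w" using assms by (simp add: hopf_proj_def)
  then have "norm w *\<^sub>R (z /\<^sub>R norm z) = w" using assms by simp
  then show ?thesis by (simp add: divide_inverse)
qed

section \<open>Topology of the Hopf surface\<close>

lemma homeomorphic_map_hopf_lift: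
  "homeomorphic_map (subtopology hopf_surface (hopf_proj ` hopf_annulus b)) (top_of_set (hopf_annulus b)) (hopf_lift b)"
proof -
  let ?U = "hopf_proj ` hopf_annulus b"
  have U: "?U \<subseteq> sphere 0 1 \<times> sphere 0 1" using hopf_chart_domain by blast
  have 1: "continuous_on ?U (hopf_lift b)"
    unfolding hopf_lift_def hopf_chart_domain
    by (intro continuous_intros) auto
  have 2: "continuous_on (hopf_annulus b) hopf_proj"
    unfolding hopf_proj_def using hopf_annulus_nonzero
    by (intro continuous_intros) auto
  have "homeomorphic_maps (top_of_set ?U) (top_of_set (hopf_annulus b)) (hopf_lift b) hopf_proj"
    unfolding homeomorphic_maps_def using 1 2 by (auto simp: hopf_lift_proj)
  moreover have "subtopology hopf_surface ?U = top_of_set ?U"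
    using U by (simp add: hopf_surface_def subtopology_subtopology inf.absorb2)
  ultimately show ?thesis using homeomorphic_map_maps by metis
qed

lemma openin_hopf_chart_domain: "openin hopf_surface (hopf_proj ` hopf_annulus b)"
proof -
  have "open {p :: (complex^2) \<times> complex. snd p * cis (- b) \<notin> \<real>\<^sub>\<le>\<^sub>0}"
  proof -
    have "open ((\<lambda>p :: (complex^2) \<times> complex. snd p * cis (- b)) -` (- \<real>\<^sub>\<le>\<^sub>0))"
      by (intro open_vimage continuous_intros) auto
    then show ?thesis by (simp add: vimage_def)
  qed
  then show ?thesis
    unfolding hopf_surface_def hopf_chart_domain openin_open by blast
qed

lemma hopf_charts_cover: "(\<Union>c\<in>range hopf_chart. fst c) = topspace hopf_surface"
proof -
  \<comment> \<open>Centring the chart at the argument of \<open>snd p\<close> rotates that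
    component to 1, away from the slit along the nonpositive reals.\<close>
  have "p \<in> fst (hopf_chart (Arg (snd p)))" if "p \<in> sphere 0 1 \<times> sphere 0 1" for p
  proof -
    have "cis (Arg (snd p)) = snd p" using that by (subst cis_Arg) (auto simp: sgn_div_norm)
    then have "snd p * cis (- Arg (snd p)) = 1" by (metis cis_mult cis_zero add.right_inverse)
    then show ?thesis using that by (simp add: hopf_chart_def hopf_chart_domain)
  qed
  then show ?thesis
    by (auto simp: hopf_surface_def hopf_chart_def hopf_chart_domain)
qed

lemma compact_hopf_surface: "compact_space hopf_surface"
  unfolding hopf_surface_def
  by (simp add: compact_space_subtopology compact_Times)

lemma connected_hopf_surface: "connected_space hopf_surface"
  unfolding hopf_surface_def
  by (simp add: connected_space_subtopology connected_Times connected_sphere)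

lemma Hausdorff_hopf_surface: "Hausdorff_space hopf_surface"
  unfolding hopf_surface_def by (simp add: Hausdorff_space_subtopology)

lemma second_countable_hopf_surface: "second_countable hopf_surface"
proof -
  obtain \<B> :: "((complex^2) \<times> complex) set set" where "countable \<B>" "\<And>C. C \<in> \<B> \<Longrightarrow> open C"
    "\<And>S. open S \<Longrightarrow> \<exists>U. U \<subseteq> \<B> \<and> S = \<Union>U"
    using univ_second_countable by metis
  then have "second_countable (euclidean :: ((complex^2) \<times> complex) topology)"
    unfolding second_countable_def open_openin[symmetric]
    by (intro exI[of _ \<B>]) (blast)
  then show ?thesis unfolding hopf_surface_def by (rule second_countable_subtopology)
qed

lemma homothety_atlas_hopf: "homothety_atlas (range hopf_chart)"
proof
  fix c :: "((complex^2) \<times> complex, 2) chart"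
  assume "c \<in> range hopf_chart"
  then obtain b where c: "c = hopf_chart b" by blast
  have image: "snd c ` fst c = hopf_annulus b" by (simp add: c snd_hopf_chart_image)
  show "open (snd c ` fst c)" unfolding image by (rule open_hopf_annulus)
  show "inj_on (snd c) (fst c)" using inj_on_hopf_lift by (simp add: c hopf_chart_def)
  show "0 \<notin> snd c ` fst c" unfolding image using hopf_annulus_nonzero by blast
  fix d :: "((complex^2) \<times> complex, 2) chart" and p
  assume "d \<in> range hopf_chart" and p: "p \<in> fst c" "p \<in> fst d"
  then obtain b' where d: "d = hopf_chart b'" by blast
  have image': "snd d ` fst d = hopf_annulus b'" by (simp add: d snd_hopf_chart_image)
  let ?x = "snd c p" and ?y = "snd d p"
  have xy: "?x \<in> hopf_annulus b" "?y \<in> hopf_annulus b'" using p image image' by auto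
  have nz: "?x \<noteq> 0" "?y \<noteq> 0" using xy hopf_annulus_nonzero by auto
  have "p \<in> sphere 0 1 \<times> sphere 0 1"
    using p(1) hopf_proj_in_surface hopf_annulus_nonzero by (auto simp: c hopf_chart_def)
  then have proj: "hopf_proj ?x = p" "hopf_proj ?y = p"
    by (simp_all add: c d hopf_chart_def hopf_proj_lift)
  define r where "r = norm ?y / norm ?x"
  have r: "r > 0" "?y = r *\<^sub>R ?x"
    using nz hopf_proj_eq_imp_scaleR[OF nz] proj by (simp_all add: r_def)
  let ?N = "hopf_annulus b \<inter> (\<lambda>y. r *\<^sub>R y) -` hopf_annulus b'"
  have "open ?N"
    by (intro open_Int open_hopf_annulus open_vimage continuous_intros)
  moreover have "?x \<in> ?N" using xy r by simp
  \<comment> \<open>\<open>r\<close> is read off at \<open>p\<close> alone; since both lifts of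
    \<open>p\<close> have the same projection, scaling by \<open>r\<close> preserves the projection
    at every \<open>y\<close>.\<close>
  moreover have "chart_inv d (r *\<^sub>R y) = chart_inv c y" if "y \<in> ?N" for y
    using that hopf_proj_scaleR[OF r(1) nz(1) hopf_annulus_nonzero[of y b]] proj r(2)
    by (simp add: c d chart_inv_hopf_chart)
  ultimately show "\<exists>r>0. \<exists>N. open N \<and> ?x \<in> N \<and> N \<subseteq> snd c ` fst c \<and>
      (\<forall>y\<in>N. r *\<^sub>R y \<in> snd d ` fst d \<and> chart_inv d (r *\<^sub>R y) = chart_inv c y)"
    unfolding image image' using r(1) by (intro exI[of _ r] conjI exI[of _ ?N]) auto
qed

interpretation hopf: homothety_atlas "range hopf_chart"
  by (rule homothety_atlas_hopf)

lemma complex_manifold_hopf: "complex_manifold hopf_surface (range hopf_chart)"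
proof -
  have "openin hopf_surface (fst c) \<and> open (snd c ` fst c) \<and>
      homeomorphic_map (subtopology hopf_surface (fst c)) (top_of_set (snd c ` fst c)) (snd c)"
    if "c \<in> range hopf_chart" for c
  proof -
    obtain b where c: "c = hopf_chart b" using \<open>c \<in> range hopf_chart\<close> by blast
    have "fst c = hopf_proj ` hopf_annulus b" "snd c = hopf_lift b" by (simp_all add: c hopf_chart_def)
    moreover have "snd c ` fst c = hopf_annulus b" by (simp add: c snd_hopf_chart_image)
    ultimately show ?thesis
      using openin_hopf_chart_domain open_hopf_annulus homeomorphic_map_hopf_lift by metis
  qed
  then show ?thesis
    unfolding complex_manifold_def case_prod_beta
    by (intro conjI ballI Hausdorff_hopf_surface second_countable_hopf_surface hopf_charts_cover
        hopf.holomorphic_transition) blast+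
qed

lemma not_flat_hopf: "\<not> flat_connection (range hopf_chart) (atlas_conn (range hopf_chart) 3 (-1) (-1))"
proof -
  \<comment> \<open>\<open>f\<close> exchanges the coordinates, so \<open>e\<close> and
    \<open>f e\<close> form the standard unitary basis; as \<open>e\<close> has norm 1 it lies in
    the annulus with b = 0.\<close>
  define e :: "complex^2" where "e = axis 1 1"
  define f :: "complex^2 \<Rightarrow> complex^2" where "f x = (\<chi> i. if i = 1 then x $ 2 else x $ 1)" for x
  have "linear f" by (rule linearI) (simp_all add: f_def vec_eq_iff)
  have e: "e $ 1 = 1" "e $ 2 = 0" by (simp_all add: e_def axis_def)
  have "norm e = 1" by (simp add: norm_eq_1 inner_vec_def sum_2 e)
  then have "e \<in> hopf_annulus 0" by (simp add: hopf_annulus_def)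
  then have c: "hopf_proj e \<in> fst (hopf_chart 0)" "snd (hopf_chart 0) (hopf_proj e) = e"
    by (simp_all add: hopf_chart_def hopf_lift_proj)
  show ?thesis
    by (rule hopf.not_flat_atlas_conn[of "hopf_chart 0" "hopf_proj e", OF _ c(1) \<open>linear f\<close>])
      (simp_all add: c(2) e f_def inner_vec_def sum_2 mult_i_def)
qed

theorem corollary5p4:
  shows "\<exists>(M :: ((complex^2) \<times> complex) topology) (A :: ((complex^2) \<times> complex, 2) chart set) g t D.
    complex_manifold M A \<and> compact_space M \<and> connected_space M \<and>
    hermitian_metric A g \<and> gauduchon_connection A g t D \<and>
    zero_hol_sect_curv A g D \<and> \<not> flat_connection A D"
proof (intro exI conjI)
  let ?A = "range hopf_chart"
  show "complex_manifold hopf_surface ?A" by (rule complex_manifold_hopf)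
  show "compact_space hopf_surface" by (rule compact_hopf_surface)
  show "connected_space hopf_surface" by (rule connected_hopf_surface)
  show "hermitian_metric ?A (atlas_metric ?A)" by (rule hopf.hermitian_atlas_metric)
  show "gauduchon_connection ?A (atlas_metric ?A) 3 (atlas_conn ?A 3 (-1) (-1))"
    \<comment> \<open>Here s = -1, which gives t = 1 - 2 s = 3.\<close>
    using hopf.gauduchon_atlas_conn[of "-1"] by simp
  show "zero_hol_sect_curv ?A (atlas_metric ?A) (atlas_conn ?A 3 (-1) (-1))"
    by (rule hopf.zero_hol_sect_curv_atlas_conn)
  show "\<not> flat_connection ?A (atlas_conn ?A 3 (-1) (-1))" by (rule not_flat_hopf)
qed

end
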